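(* Let $\mathcal H$ be a real Hilbert space and $f\colon\mathcal H\to\left]-\infty,+\infty\right]$ a proper lower semicontinuous convex Legendre function. Let $T_1,\dots,T_m\colon\mathcal H\to\mathcal H$, $\mathcal S(x)=\{x,T_1x,\dots,T_mx\}$, and $F:=\operatorname{int}\operatorname{dom} f\cap\bigcap_{i=1}^m\operatorname{Fix}T_i$. Suppose that $F$ is nonempty, closed and convex, that each $T_i$ is Bregman isometric with respect to $f$, and that $\overrightarrow{CC}_{\mathcal S}(y)$ contains at most one point for every $y\in\operatorname{int}\operatorname{dom} f$. Let $y\in\operatorname{int}\operatorname{dom} f$. Then: (i) for every $x\in\operatorname{dom} f$ and every $z\in F$, $D_f(x,z)=D_f(T_1x,z)=\cdots=D_f(T_mx,z)$; (ii) for every $z\in F$, $\overrightarrow{CC}_{\mathcal S}(y)=\{\overleftarrow P^f_{\operatorname{aff}(\mathcal S(y))}(z)\}\subseteq\operatorname{int}\operatorname{dom} f$; (iii) the iterates $(\overrightarrow{CC}_{\mathcal S}^{\,k}y)_{k\in\mathbb N}$ form a well-defined sequence in $\operatorname{int}\operatorname{dom} f$; (iv) this sequence is forward Bregman monotone with respect to $\bigcap_{i=1}^m\operatorname{Fix}T_i$; consequently $(D_f(\overrightarrow{CC}_{\mathcal S}^{\,k}y,z))_{k}$ converges for every $z\in F$; (v) $\lim_{k\to\infty}D_f(\overrightarrow{CC}_{\mathcal S}^{\,k}y,\overrightarrow{CC}_{\mathcal S}^{\,k+1}y)=0$; (vi) suppose moreover that each $T_i$ is $f$-demiclosed and that for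 every sequence $(u_k)$ in $\operatorname{int}\operatorname{dom} f$: if $D_f(u_k,\overrightarrow{CC}_{\mathcal S}u_k)\to0$ and $D_f(T_iu_k,\overrightarrow{CC}_{\mathcal S}u_k)\to0$ for all $i$, then $D_f(u_k,T_iu_k)\to0$ for all $i$. Then (a) $\overrightarrow{CC}_{\mathcal S}$ (as a map on $\operatorname{int}\operatorname{dom} f$) is $f$-demiclosed; and (b) if all weak sequential cluster points of $(\overrightarrow{CC}_{\mathcal S}^{\,k}y)_{k}$ lie in $\operatorname{int}\operatorname{dom} f$, then $(\overrightarrow{CC}_{\mathcal S}^{\,k}y)_{k}$ converges weakly to a point of $F$.
   Context: Bregman distance: $D_f(x,y)=f(x)-f(y)-\langle\nabla f(y),x-y\rangle$ if $y\in\operatorname{int}\operatorname{dom} f$, $+\infty$ otherwise. Legendre: $f$ is essentially smooth ($\operatorname{dom}\partial f=\operatorname{int}\operatorname{dom} f\neq\varnothing$, Gâteaux differentiable on $\operatorname{int}\operatorname{dom} f$, $\|\nabla f(x_k)\|\to\infty$ whenever $(x_k)\subseteq\operatorname{int}\operatorname{dom} f$ converges to a boundary point of $\operatorname{dom} f$) and essentially strictly convex ($(\partial f)^{-1}$ locally bounded on its domain and $f$ strictly convex on every convex subset of $\operatorname{dom}\partial f$). Forward Bregman circumcenter mapping: for $y$ with $\mathcal S(y)\subseteq\operatorname{dom} f$, $\overrightarrow{CC}_{\mathcal S}(y)=\{v\in\operatorname{aff}(\mathcal S(y))\cap\operatorname{int}\operatorname{dom} f: D_f(y,v)=D_f(T_1y,v)=\cdots=D_f(T_my,v)\}$;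 when it is a singleton it is identified with its element (so iterates make sense). $\operatorname{aff}$ = affine hull. Backward Bregman projection: $\overleftarrow P^f_C(y)=\{u\in C\cap\operatorname{dom} f: D_f(u,y)\le D_f(c,y)\ \forall c\in C\}$ for $y\in\operatorname{int}\operatorname{dom} f$. Bregman isometry: $T$ is Bregman isometric w.r.t. $f$ if for all $(x,y)\in\operatorname{dom} f\times\operatorname{int}\operatorname{dom} f$, $(Tx,Ty)\in\operatorname{dom} f\times\operatorname{int}\operatorname{dom} f$ and $D_f(Tx,Ty)=D_f(x,y)$. Forward Bregman monotone: $(x_k)$ is forward Bregman monotone w.r.t. $C$ if $C\cap\operatorname{int}\operatorname{dom} f\neq\varnothing$, all $x_k\in\operatorname{int}\operatorname{dom} f$, and $D_f(x_{k+1},c)\le D_f(x_k,c)$ for all $c\in C\cap\operatorname{int}\operatorname{dom} f$, $k$. $f$-demiclosed: an operator $G$ defined on $\mathcal C$ is $f$-demiclosed if for every $x\in\mathcal C\cap\operatorname{int}\operatorname{dom} f$ and every sequence $(x_k)$ in $\operatorname{int}\operatorname{dom} f$ with $(Gx_k)$ in $\operatorname{int}\operatorname{dom} f$, $x_k\rightharpoonup x$ and $D_f(x_k,Gx_k)\to0$ imply $x\in\operatorname{Fix}G$. *)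

theory Defs
  imports "HOL-Analysis.Analysis" "HOL-Library.Extended_Real"
begin

definition edom :: "('a \<Rightarrow> ereal) \<Rightarrow> 'a set" where
  "edom f = {x. f x < \<infinity>}"

definition proper_fun :: "('a \<Rightarrow> ereal) \<Rightarrow> bool" where
  "proper_fun f \<longleftrightarrow> (\<forall>x. f x \<noteq> -\<infinity>) \<and> (\<exists>x. f x < \<infinity>)"

definition lsc_fun :: "('a::topological_space \<Rightarrow> ereal) \<Rightarrow> bool" where
  "lsc_fun f \<longleftrightarrow> (\<forall>x xs. xs \<longlonglongrightarrow> x \<longrightarrow> f x \<le> liminf (\<lambda>k. f (xs k)))"

definition convex_fun :: "('a::real_vector \<Rightarrow> ereal) \<Rightarrow> bool" where
  "convex_fun f \<longleftrightarrow> (\<forall>x y t. 0 \<le> t \<and> t \<le> 1 \<longrightarrow>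
      f (t *\<^sub>R x + (1 - t) *\<^sub>R y) \<le> ereal t * f x + ereal (1 - t) * f y)"

definition subdiff :: "('a::real_inner \<Rightarrow> ereal) \<Rightarrow> 'a \<Rightarrow> 'a set" where
  "subdiff f x = {u. f x < \<infinity> \<and> (\<forall>y. f x + ereal (inner u (y - x)) \<le> f y)}"

definition dom_subdiff :: "('a::real_inner \<Rightarrow> ereal) \<Rightarrow> 'a set" where
  "dom_subdiff f = {x. subdiff f x \<noteq> {}}"

definition gateaux_grad :: "('a::real_inner \<Rightarrow> ereal) \<Rightarrow> 'a \<Rightarrow> 'a \<Rightarrow> bool" where
  "gateaux_grad f x u \<longleftrightarrow> f x \<noteq> \<infinity> \<and> f x \<noteq> -\<infinity> \<and>
     (\<forall>h. ((\<lambda>t. (f (x + t *\<^sub>R h) - f x) / ereal t) \<longlongrightarrow> ereal (inner u h)) (at 0))"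

definition grad :: "('a::real_inner \<Rightarrow> ereal) \<Rightarrow> 'a \<Rightarrow> 'a" where
  "grad f x = (SOME u. gateaux_grad f x u)"

definition essentially_smooth :: "('a::{real_inner,complete_space} \<Rightarrow> ereal) \<Rightarrow> bool" where
  "essentially_smooth f \<longleftrightarrow>
     dom_subdiff f = interior (edom f) \<and> interior (edom f) \<noteq> {} \<and>
     (\<forall>x \<in> interior (edom f). \<exists>u. gateaux_grad f x u) \<and>
     (\<forall>xs x. (\<forall>k. xs k \<in> interior (edom f)) \<and> xs \<longlonglongrightarrow> x \<and> x \<in> frontier (edom f) \<longrightarrow>
        filterlim (\<lambda>k. norm (grad f (xs k))) at_top sequentially)"

definition strictly_convex_on_set :: "'a::real_vector set \<Rightarrow> ('a \<Rightarrow> ereal) \<Rightarrow> bool" where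
  "strictly_convex_on_set C f \<longleftrightarrow> (\<forall>x\<in>C. \<forall>y\<in>C. \<forall>t. x \<noteq> y \<and> 0 < t \<and> t < 1 \<longrightarrow>
      f (t *\<^sub>R x + (1 - t) *\<^sub>R y) < ereal t * f x + ereal (1 - t) * f y)"

definition inv_subdiff_locally_bounded :: "('a::real_inner \<Rightarrow> ereal) \<Rightarrow> bool" where
  "inv_subdiff_locally_bounded f \<longleftrightarrow>
     (\<forall>u \<in> (\<Union>x. subdiff f x). \<exists>\<delta>>0. bounded {x. \<exists>v \<in> subdiff f x. dist v u < \<delta>})"

definition essentially_strictly_convex :: "('a::real_inner \<Rightarrow> ereal) \<Rightarrow> bool" where
  "essentially_strictly_convex f \<longleftrightarrow> inv_subdiff_locally_bounded f \<and>
     (\<forall>C. convex C \<and> C \<subseteq> dom_subdiff f \<longrightarrow> strictly_convex_on_set C f)"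

definition legendre :: "('a::{real_inner,complete_space} \<Rightarrow> ereal) \<Rightarrow> bool" where
  "legendre f \<longleftrightarrow> essentially_smooth f \<and> essentially_strictly_convex f"

definition bregman :: "('a::real_inner \<Rightarrow> ereal) \<Rightarrow> 'a \<Rightarrow> 'a \<Rightarrow> ereal" where
  "bregman f x y = (if y \<in> interior (edom f)
      then f x - f y - ereal (inner (grad f y) (x - y)) else \<infinity>)"

definition Fix :: "('a \<Rightarrow> 'a) \<Rightarrow> 'a set" where
  "Fix T = {x. T x = x}"

definition Sset :: "nat \<Rightarrow> (nat \<Rightarrow> 'a \<Rightarrow> 'a) \<Rightarrow> 'a \<Rightarrow> 'a set" where
  "Sset m T x = insert x ((\<lambda>i. T i x) ` {1..m})"

definition fwd_cc_set :: "('a::real_inner \<Rightarrow> ereal) \<Rightarrow> nat \<Rightarrow> (nat \<Rightarrow> 'a \<Rightarrow> 'a) \<Rightarrow> 'a \<Rightarrow> 'a set" where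
  "fwd_cc_set f m T y = (if Sset m T y \<subseteq> edom f then
     {v \<in> affine hull (Sset m T y) \<inter> interior (edom f).
        \<forall>i\<in>{1..m}. bregman f (T i y) v = bregman f y v} else {})"

definition fwd_cc :: "('a::real_inner \<Rightarrow> ereal) \<Rightarrow> nat \<Rightarrow> (nat \<Rightarrow> 'a \<Rightarrow> 'a) \<Rightarrow> 'a \<Rightarrow> 'a" where
  "fwd_cc f m T y = the_elem (fwd_cc_set f m T y)"

definition bwd_proj :: "('a::real_inner \<Rightarrow> ereal) \<Rightarrow> 'a set \<Rightarrow> 'a \<Rightarrow> 'a set" where
  "bwd_proj f C y = {u \<in> C \<inter> edom f. \<forall>c\<in>C. bregman f u y \<le> bregman f c y}"

definition bregman_isometric :: "('a::real_inner \<Rightarrow> ereal) \<Rightarrow> ('a \<Rightarrow> 'a) \<Rightarrow> bool" where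
  "bregman_isometric f T \<longleftrightarrow> (\<forall>x \<in> edom f. \<forall>y \<in> interior (edom f).
      T x \<in> edom f \<and> T y \<in> interior (edom f) \<and> bregman f (T x) (T y) = bregman f x y)"

definition fwd_bregman_monotone :: "('a::real_inner \<Rightarrow> ereal) \<Rightarrow> 'a set \<Rightarrow> (nat \<Rightarrow> 'a) \<Rightarrow> bool" where
  "fwd_bregman_monotone f C xs \<longleftrightarrow> C \<inter> interior (edom f) \<noteq> {} \<and>
     (\<forall>k. xs k \<in> interior (edom f)) \<and>
     (\<forall>c \<in> C \<inter> interior (edom f). \<forall>k. bregman f (xs (Suc k)) c \<le> bregman f (xs k) c)"

definition weakly_tendsto :: "(nat \<Rightarrow> 'a::real_inner) \<Rightarrow> 'a \<Rightarrow> bool" where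
  "weakly_tendsto xs x \<longleftrightarrow> (\<forall>v. (\<lambda>k. inner (xs k) v) \<longlonglongrightarrow> inner x v)"

definition f_demiclosed :: "('a::real_inner \<Rightarrow> ereal) \<Rightarrow> 'a set \<Rightarrow> ('a \<Rightarrow> 'a) \<Rightarrow> bool" where
  "f_demiclosed f C G \<longleftrightarrow> (\<forall>x \<in> C \<inter> interior (edom f). \<forall>xs.
     (\<forall>k. xs k \<in> interior (edom f) \<and> G (xs k) \<in> interior (edom f)) \<and>
     weakly_tendsto xs x \<and> (\<lambda>k. bregman f (xs k) (G (xs k))) \<longlonglongrightarrow> 0
     \<longrightarrow> x \<in> Fix G)"

end

theory Submission
  imports Defs "HOL-Complex_Analysis.Great_Picard"
begin

text \<open>For a common fixed point \<open>z\<close>, isometry makes \<open>D_f(\<cdot>, z)\<close> constant on \<open>S(y)\<close>. A minimizer \<open>p\<close> of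
  \<open>D_f(\<cdot>, z)\<close> over the finite-dimensional affine hull of \<open>S(y)\<close> exists by coercivity and lies in the
  interior of the domain by essential smoothness; its optimality condition
  \<open>\<nabla>f(p) - \<nabla>f(z) \<bottom> aff S(y) - aff S(y)\<close> says that \<open>p\<close> is a circumcenter, hence the only one, and
  gives the Pythagorean identity \<open>D_f(y, z) = D_f(y, p) + D_f(p, z)\<close>. Telescoping yields Fejer
  monotonicity and asymptotic regularity. Iterates are bounded by coercivity; for weak cluster
  points \<open>p, q\<close> in \<open>F\<close> the sequence \<open>\<langle>x\<^sub>k, \<nabla>f(q) - \<nabla>f(p)\<rangle>\<close> converges, so
  \<open>\<langle>q - p, \<nabla>f(q) - \<nabla>f(p)\<rangle> = 0\<close> and \<open>p = q\<close> by strict convexity.\<close>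

section \<open>Hilbert spaces\<close>

text \<open>A minimizing sequence is Cauchy: midpoints cannot fall below the infimum, so the
  quadratic gap bounds the squared distances. The hypothesis \<open>closed\<close> is lower
  semicontinuity along sequences whose values converge, so \<open>E\<close> itself may fail to be
  closed. This serves orthogonal projections and proximal points alike.\<close>

lemma minimizer_strongly_midconvex:
  fixes G :: "'a::{real_inner,complete_space} \<Rightarrow> real"
  assumes ne: "E \<noteq> {}"
    and bdd: "\<And>x. x \<in> E \<Longrightarrow> b \<le> G x"
    and mid: "\<And>x y. x \<in> E \<Longrightarrow> y \<in> E \<Longrightarrow>
        (1/2) *\<^sub>R (x + y) \<in> E \<and> G ((1/2) *\<^sub>R (x + y)) \<le> (G x + G y) / 2 - (norm (x - y))\<^sup>2 / 8"
    and closed: "\<And>xs x l. (\<And>k::nat. xs k \<in> E) \<Longrightarrow> xs \<longlonglongrightarrow> x \<Longrightarrow> (\<lambda>k. G (xs k)) \<longlonglongrightarrow> l \<Longrightarrow>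
        x \<in> E \<and> G x \<le> l"
  obtains p where "p \<in> E" "\<And>x. x \<in> E \<Longrightarrow> G p \<le> G x"
proof -
  define i where "i = Inf (G ` E)"
  have bb: "bdd_below (G ` E)" by (rule bdd_belowI2[of E b]) (rule bdd)
  have i_le: "i \<le> G x" if "x \<in> E" for x
    unfolding i_def using bb that by (simp add: cInf_lower)
  have "\<exists>x\<in>E. G x < i + inverse (real (Suc k))" for k
    using cInf_lessD[of "G ` E" "i + inverse (real (Suc k))"] ne by (force simp: i_def)
  then obtain xs where xs: "\<And>k. xs k \<in> E" "\<And>k. G (xs k) < i + inverse (real (Suc k))"
    by metis
  have lim: "(\<lambda>k. G (xs k)) \<longlonglongrightarrow> i"
  proof (rule tendsto_sandwich[OF _ _ tendsto_const])
    show "(\<lambda>k. i + inverse (real (Suc k))) \<longlonglongrightarrow> i"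
      using tendsto_add[OF tendsto_const[of i] LIMSEQ_inverse_real_of_nat]
      by simp
  qed (use xs i_le in \<open>auto intro!: always_eventually less_imp_le\<close>)
  have dist: "(norm (xs j - xs k))\<^sup>2 \<le> 8 * (inverse (real (Suc n)))" if "j \<ge> n" "k \<ge> n" for j k n
  proof -
    have "i \<le> (G (xs j) + G (xs k)) / 2 - (norm (xs j - xs k))\<^sup>2 / 8"
      using mid[OF xs(1) xs(1)] i_le by (meson order_trans)
    moreover have "inverse (real (Suc j)) \<le> inverse (real (Suc n))" "inverse (real (Suc k)) \<le> inverse (real (Suc n))"
      using that by (auto intro!: le_imp_inverse_le)
    ultimately show ?thesis using xs(2)[of j] xs(2)[of k] by argo
  qed
  have "Cauchy xs"
  proof (rule CauchyI)
    fix e :: real assume e: "0 < e"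
    then obtain n where n: "inverse (real (Suc n)) < e\<^sup>2 / 8"
      using nat_approx_posE[of "e\<^sup>2 / 8"] by (auto simp: inverse_eq_divide)
    have "norm (xs j - xs k) < e" if "j \<ge> n" "k \<ge> n" for j k
    proof (rule power_less_imp_less_base)
      show "(norm (xs j - xs k))\<^sup>2 < e\<^sup>2" using dist[OF that] n by argo
    qed (use e in simp)
    then show "\<exists>M. \<forall>m\<ge>M. \<forall>n\<ge>M. norm (xs m - xs n) < e" by blast
  qed
  then obtain p where "xs \<longlonglongrightarrow> p"
    using Cauchy_convergent convergent_def by blast
  from closed[OF xs(1) this lim] i_le show ?thesis
    by (meson order_trans that)
qed

lemma half_sum_norm_power2:
  fixes x y w :: "'a::real_inner"
  shows "(norm ((1/2) *\<^sub>R (x + y) - w))\<^sup>2 = ((norm (x - w))\<^sup>2 + (norm (y - w))\<^sup>2) / 2 - (norm (x - y))\<^sup>2 / 4"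
  by (simp add: power2_norm_eq_inner inner_simps inner_commute) (simp add: field_simps)

text \<open>By the parallelogram identity, half the squared distance to \<open>v\<close> satisfies
  the midpoint inequality with exactly the constant 1/8.\<close>

lemma orthogonal_projection_exists:
  fixes M :: "'a::{real_inner,complete_space} set"
  assumes M: "subspace M" "closed M"
  obtains p where "p \<in> M" "\<And>x. x \<in> M \<Longrightarrow> inner (v - p) x = 0"
proof -
  obtain p where p: "p \<in> M" and min: "\<And>x. x \<in> M \<Longrightarrow> (norm (p - v))\<^sup>2 / 2 \<le> (norm (x - v))\<^sup>2 / 2"
  proof (rule minimizer_strongly_midconvex[of M 0 "\<lambda>x. (norm (x - v))\<^sup>2 / 2"])
    show "M \<noteq> {}" using M(1) subspace_0 by blast
    fix xs :: "nat \<Rightarrow> 'a" and x l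
    assume xs: "\<And>k. xs k \<in> M" "xs \<longlonglongrightarrow> x" and l: "(\<lambda>k. (norm (xs k - v))\<^sup>2 / 2) \<longlonglongrightarrow> l"
    have "(\<lambda>k. (norm (xs k - v))\<^sup>2 / 2) \<longlonglongrightarrow> (norm (x - v))\<^sup>2 / 2"
      by (intro tendsto_intros xs) auto
    with l xs M(2) show "x \<in> M \<and> (norm (x - v))\<^sup>2 / 2 \<le> l"
      using LIMSEQ_unique closed_sequential_limits by (metis order_refl)
  qed (use M(1) in \<open>auto simp: half_sum_norm_power2 subspace_scale subspace_add
        simp del: scaleR_half_double\<close>)
  have "inner (v - p) x = 0" if x: "x \<in> M" for x
  proof -
    \<comment> \<open>For \<open>x \<noteq> 0\<close> this value minimizes the quadratic that gives
      the squared distance from \<open>p + t *\<^sub>R x\<close> to \<open>v\<close>.\<close>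
    define t where "t = inner (v - p) x / inner x x"
    have "(norm (p - v))\<^sup>2 \<le> (norm (p + t *\<^sub>R x - v))\<^sup>2"
      using min[of "p + t *\<^sub>R x"] p x M(1) by (simp add: subspace_add subspace_scale)
    also have "(norm (p + t *\<^sub>R x - v))\<^sup>2 = (norm (p - v))\<^sup>2 - 2 * t * inner (v - p) x + t\<^sup>2 * inner x x"
      unfolding power2_norm_eq_inner by (simp add: inner_simps inner_commute) (simp add: power2_eq_square algebra_simps)
    finally have le: "2 * t * inner (v - p) x \<le> t\<^sup>2 * inner x x" by simp
    show ?thesis
    proof (cases "x = 0")
      case False
      then have "inner x x > 0" by simp
      then have "(inner (v - p) x)\<^sup>2 / inner x x \<le> 0"
        using le by (simp add: t_def power2_eq_square field_simps)
      then show ?thesis using \<open>inner x x > 0\<close> by (simp add: divide_le_0_iff)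
    qed simp
  qed
  with p that show ?thesis by blast
qed

text \<open>Removing from \<open>v\<close> its projection onto the kernel \<open>M\<close> leaves a
  vector \<open>w\<close> orthogonal to \<open>M\<close>, and every \<open>x\<close> is a multiple
  of \<open>w\<close> plus an element of \<open>M\<close>.\<close>

lemma riesz_representation:
  fixes h :: "'a::{real_inner,complete_space} \<Rightarrow> real"
  assumes h: "bounded_linear h"
  obtains p where "\<And>x. h x = inner p x"
proof (cases "\<forall>x. h x = 0")
  case True
  then show ?thesis using that[of 0] by simp
next
  case False
  then obtain v where v: "h v \<noteq> 0" by blast
  interpret bounded_linear h by fact
  define M where "M = {x. h x = 0}"
  have "subspace M" by (auto simp: M_def subspace_def add scaleR zero)
  moreover have "closed M"
    unfolding M_def by (intro closed_Collect_eq continuous_on_const linear_continuous_on h)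
  ultimately obtain q where q: "q \<in> M" "\<And>x. x \<in> M \<Longrightarrow> inner (v - q) x = 0"
    using orthogonal_projection_exists by blast
  define w where "w = v - q"
  have hw: "h w = h v" using q(1) by (simp add: w_def diff M_def)
  then have "w \<noteq> 0" using v zero by force
  have "h x = inner ((h w / inner w w) *\<^sub>R w) x" for x
  proof -
    have "inner w (x - (h x / h w) *\<^sub>R w) = 0"
      using q(2) v hw by (auto simp: w_def[symmetric] M_def diff scaleR)
    then show ?thesis using \<open>w \<noteq> 0\<close> v hw by (simp add: inner_simps field_simps)
  qed
  then show ?thesis using that by blast
qed

text \<open>A diagonal subsequence makes the inner products with all terms \<open>xs j\<close>
  converge. The vectors with convergent inner products form a closed subspace \<open>M\<close>
  containing the sequence, and components orthogonal to \<open>M\<close> are invisible to the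
  sequence, so every \<open>v\<close> qualifies. The limit functional is bounded by
  \<open>B\<close>, and Riesz turns it into a point.\<close>

lemma bounded_imp_weakly_convergent_subseq:
  fixes xs :: "nat \<Rightarrow> 'a::{real_inner,complete_space}"
  assumes "bounded (range xs)"
  obtains r p where "strict_mono (r :: nat \<Rightarrow> nat)" "weakly_tendsto (xs \<circ> r) p"
proof -
  obtain B where B: "B > 0" "\<And>k. norm (xs k) \<le> B"
    using assms by (auto simp: bounded_pos)
  obtain r :: "nat \<Rightarrow> nat" where r: "strict_mono r"
    and conv_xs: "\<And>j. j \<in> UNIV \<Longrightarrow> \<exists>l. (\<lambda>k. inner (xs (r k)) (xs j)) \<longlonglongrightarrow> l"
  proof (rule function_convergent_subsequence[of UNIV "\<lambda>k j. inner (xs k) (xs j)" "B * B"])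
    show "norm (inner (xs k) (xs j)) \<le> B * B" for k j
      by (rule order_trans[of _ "norm (xs k) * norm (xs j)"])
         (auto simp: Cauchy_Schwarz_ineq2 intro!: mult_mono B B(1)[THEN less_imp_le])
  qed auto
  define M where "M = {v. convergent (\<lambda>k. inner (xs (r k)) v)}"
  have xM: "xs j \<in> M" for j using conv_xs by (auto simp: M_def convergent_def)
  have subM: "subspace M"
    by (auto simp: M_def subspace_def inner_simps convergent_const intro: convergent_add convergent_mult)
  \<comment> \<open>The uniform bound \<open>B\<close> on the sequence allows a three-epsilon
    argument.\<close>
  have "closed M"
  proof (clarsimp simp: closed_sequential_limits)
    fix vs v assume vs: "\<forall>n. vs n \<in> M" "vs \<longlonglongrightarrow> v"
    have "Cauchy (\<lambda>k. inner (xs (r k)) v)"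
    proof (rule CauchyI)
      fix e :: real assume e: "0 < e"
      then have "\<forall>\<^sub>F n in sequentially. norm (vs n - v) < e / (3 * B)"
        using vs(2) B(1) by (auto simp: tendsto_iff dist_norm)
      then obtain n where n: "norm (vs n - v) < e / (3 * B)" by (auto simp: eventually_sequentially)
      have near: "\<bar>inner (xs k) v - inner (xs k) (vs n)\<bar> < e / 3" for k
      proof -
        have "\<bar>inner (xs k) v - inner (xs k) (vs n)\<bar> = \<bar>inner (xs k) (vs n - v)\<bar>"
          by (simp add: inner_simps abs_minus_commute)
        also have "\<dots> \<le> norm (xs k) * norm (vs n - v)" by (rule Cauchy_Schwarz_ineq2)
        also have "\<dots> \<le> B * norm (vs n - v)" by (simp add: B mult_right_mono)
        also have "\<dots> < e / 3" using n B(1) by (simp add: field_simps)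
        finally show ?thesis .
      qed
      have "Cauchy (\<lambda>k. inner (xs (r k)) (vs n))"
        using vs(1) by (simp add: M_def convergent_Cauchy)
      then obtain N where N: "\<And>j k. j \<ge> N \<Longrightarrow> k \<ge> N \<Longrightarrow> \<bar>inner (xs (r j)) (vs n) - inner (xs (r k)) (vs n)\<bar> < e / 3"
        using CauchyD[of "\<lambda>k. inner (xs (r k)) (vs n)" "e / 3"] e by auto
      have "norm (inner (xs (r j)) v - inner (xs (r k)) v) < e" if "j \<ge> N" "k \<ge> N" for j k
        using N[OF that] near[of "r j"] near[of "r k"] by (simp add: abs_if split: if_splits)
      then show "\<exists>M. \<forall>m\<ge>M. \<forall>n\<ge>M. norm (inner (xs (r m)) v - inner (xs (r n)) v) < e" by blast
    qed
    then show "v \<in> M" by (simp add: M_def Cauchy_convergent_iff)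
  qed
  have "v \<in> M" for v
  proof -
    obtain p where p: "p \<in> M" "\<And>x. x \<in> M \<Longrightarrow> inner (v - p) x = 0"
      using orthogonal_projection_exists[OF subM \<open>closed M\<close>] by blast
    have "inner (xs (r k)) v = inner (xs (r k)) p" for k
      using p(2)[OF xM] by (simp add: inner_simps inner_commute)
    with p(1) show ?thesis by (simp add: M_def)
  qed
  then have "\<exists>l. \<forall>v. (\<lambda>k. inner (xs (r k)) v) \<longlonglongrightarrow> l v"
    by (auto simp: M_def convergent_def intro!: choice)
  then obtain l where l: "\<And>v. (\<lambda>k. inner (xs (r k)) v) \<longlonglongrightarrow> l v" by blast
  have "bounded_linear l"
  proof (rule bounded_linear_intro[where K = B])
    show "l (x + y) = l x + l y" for x y
      using LIMSEQ_unique[OF l[of "x + y"]] tendsto_add[OF l[of x] l[of y]] by (simp add: inner_simps)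
    show "l (c *\<^sub>R x) = c *\<^sub>R l x" for c x
      using LIMSEQ_unique[OF l[of "c *\<^sub>R x"]] tendsto_mult[OF tendsto_const[of c] l[of x]] by (simp add: inner_simps)
    show "norm (l x) \<le> norm x * B" for x
    proof (rule LIMSEQ_le_const2[OF tendsto_norm[OF l[of x]]], intro exI allI impI)
      fix k
      have "norm (inner (xs (r k)) x) \<le> norm (xs (r k)) * norm x"
        by (simp add: Cauchy_Schwarz_ineq2)
      also have "\<dots> \<le> norm x * B"
        using mult_right_mono[OF B(2)[of "r k"] norm_ge_zero[of x]] by (simp add: mult.commute)
      finally show "norm (inner (xs (r k)) x) \<le> norm x * B" .
    qed
  qed
  then obtain p where "\<And>x. l x = inner p x" using riesz_representation by blast
  with l have "weakly_tendsto (xs \<circ> r) p" by (simp add: weakly_tendsto_def o_def)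
  with r show ?thesis by (rule that)
qed

text \<open>If convergence failed against some \<open>v\<close>, a subsequence would stay
  \<open>e\<close> away from the expected value, yet by weak compactness it has a further
  subsequence tending weakly to \<open>p\<close>.\<close>

lemma weakly_tendsto_of_unique_cluster:
  fixes xs :: "nat \<Rightarrow> 'a::{real_inner,complete_space}"
  assumes bdd: "bounded (range xs)"
    and uniq: "\<And>r q. strict_mono r \<Longrightarrow> weakly_tendsto (xs \<circ> r) q \<Longrightarrow> q = p"
  shows "weakly_tendsto xs p"
proof (rule ccontr)
  assume "\<not> weakly_tendsto xs p"
  then obtain v where "\<not> (\<lambda>k. inner (xs k) v) \<longlonglongrightarrow> inner p v"
    by (auto simp: weakly_tendsto_def)
  then obtain e where e: "e > 0" and far: "\<not> (\<forall>\<^sub>F k in sequentially. dist (inner (xs k) v) (inner p v) < e)"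
    by (auto simp: tendsto_iff)
  have "\<exists>\<^sub>F k in sequentially. dist (inner (xs k) v) (inner p v) \<ge> e"
    using far by (simp add: frequently_def not_le)
  then have "infinite {k. dist (inner (xs k) v) (inner p v) \<ge> e}"
    using frequently_cofinite by (metis cofinite_eq_sequentially)
  then obtain r :: "nat \<Rightarrow> nat" where r: "strict_mono r" "\<And>k. dist (inner (xs (r k)) v) (inner p v) \<ge> e"
    using infinite_enumerate by blast
  have "bounded (range (xs \<circ> r))" using bdd by (rule bounded_subset) auto
  then obtain s q where s: "strict_mono s" "weakly_tendsto ((xs \<circ> r) \<circ> s) q"
    using bounded_imp_weakly_convergent_subseq by blast
  then have "q = p" using uniq[of "r \<circ> s" q] r(1) by (simp add: o_assoc strict_mono_o)
  with s(2) have "(\<lambda>k. inner (xs (r (s k))) v) \<longlonglongrightarrow> inner p v"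
    by (auto simp: weakly_tendsto_def o_def)
  then have "\<forall>\<^sub>F k in sequentially. dist (inner (xs (r (s k))) v) (inner p v) < e"
    using e by (auto simp: tendsto_iff)
  then obtain k where "dist (inner (xs (r (s k))) v) (inner p v) < e"
    by (auto simp: eventually_sequentially)
  then show False using r(2)[of "s k"] by simp
qed

text \<open>On the finite-dimensional affine hull a point is recovered from finitely many inner
  products with an orthogonal spanning set, so a weakly convergent subsequence converges in
  norm.\<close>

lemma bounded_seq_affine_hull_convergent_subseq:
  fixes xs :: "nat \<Rightarrow> 'a::{real_inner,complete_space}"
  assumes "finite S" and xs: "\<And>k. xs k \<in> affine hull S" and bdd: "bounded (range xs)"
  obtains r p where "strict_mono (r :: nat \<Rightarrow> nat)" "p \<in> affine hull S" "(xs \<circ> r) \<longlonglongrightarrow> p"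
proof -
  define a where "a = xs 0"
  have A: "affine hull S = (+) a ` span ((\<lambda>x. - a + x) ` S)"
    using affine_hull_span_gen[of a S] xs by (simp add: a_def)
  obtain C where C: "finite C" "pairwise orthogonal C" "span C = span ((\<lambda>x. - a + x) ` S)"
    using basis_orthogonal[of "(\<lambda>x. - a + x) ` S"] \<open>finite S\<close> by auto
  define P where "P x = (\<Sum>c\<in>C. (inner (x - a) c / inner c c) *\<^sub>R c)" for x
  have PC: "P x \<in> span C" for x
    unfolding P_def by (intro span_sum span_scale span_base)
  then have PA: "a + P x \<in> affine hull S" for x
    by (simp add: A C(3))
  have P: "x = a + P x" if "x \<in> affine hull S" for x
  proof -
    \<comment> \<open>The residual lies in \<open>span C\<close> and is orthogonal to
      \<open>C\<close>, hence to itself.\<close>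
    define w where "w = x - a - P x"
    have "x - a \<in> span C" using that by (auto simp: A C(3))
    then have w: "w \<in> span C"
      unfolding w_def using PC by (rule span_diff)
    have orth: "orthogonal w c" if "c \<in> C" for c
    proof -
      have "inner (P x) c = (\<Sum>d\<in>C. if d = c then inner (x - a) c else 0)"
        unfolding P_def inner_sum_left
        using C(2) that by (intro sum.cong) (auto simp: pairwise_def orthogonal_def)
      then show ?thesis using that C(1) by (simp add: w_def orthogonal_def inner_diff_left)
    qed
    have "orthogonal w w"
      by (rule orthogonal_to_span[OF w]) (use orth in auto)
    then have "w = 0" by (simp add: orthogonal_def)
    then show ?thesis by (simp add: w_def algebra_simps)
  qed
  obtain r q where r: "strict_mono r" "weakly_tendsto (xs \<circ> r) q"
    using bounded_imp_weakly_convergent_subseq[OF bdd] by blast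
  have "(\<lambda>k. a + P (xs (r k))) \<longlonglongrightarrow> a + P q"
    using r(2) unfolding P_def inner_diff_left divide_inverse
    by (intro tendsto_add tendsto_const tendsto_sum tendsto_scaleR tendsto_mult tendsto_diff)
      (simp add: weakly_tendsto_def)
  then have "(xs \<circ> r) \<longlonglongrightarrow> a + P q" using P[OF xs] by (simp add: o_def)
  with r(1) PA show ?thesis by (rule that)
qed

section \<open>Bregman distances of Legendre functions\<close>

locale legendre_function =
  fixes f :: "'a::{real_inner,complete_space} \<Rightarrow> ereal"
  assumes proper: "proper_fun f" and lsc: "lsc_fun f" and cvx: "convex_fun f"
    and leg: "legendre f"
begin

abbreviation U :: "'a set" where "U \<equiv> interior (edom f)"

text \<open>Real values give access to ordinary limits and arithmetic. Outside \<open>edom f\<close>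
  the value is the default 0, so facts about \<open>\<phi>\<close> carry membership in
  \<open>edom f\<close>.\<close>

definition \<phi> :: "'a \<Rightarrow> real" where "\<phi> x = real_of_ereal (f x)"

definition D :: "'a \<Rightarrow> 'a \<Rightarrow> real" where
  "D x z = \<phi> x - \<phi> z - inner (grad f z) (x - z)"

lemma interior_in_edom: "x \<in> U \<Longrightarrow> x \<in> edom f"
  using interior_subset by blast

lemma f_eq: "x \<in> edom f \<Longrightarrow> f x = ereal (\<phi> x)"
  using proper by (cases "f x") (auto simp: proper_fun_def edom_def \<phi>_def)

lemma f_outside: "x \<notin> edom f \<Longrightarrow> f x = \<infinity>"
  by (simp add: edom_def)

lemma edom_iff: "x \<in> edom f \<longleftrightarrow> f x < \<infinity>"
  by (simp add: edom_def)

lemma \<phi>_convex: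
  assumes "x \<in> edom f" "y \<in> edom f" "0 \<le> t" "t \<le> 1"
  shows "t *\<^sub>R x + (1 - t) *\<^sub>R y \<in> edom f"
    and "\<phi> (t *\<^sub>R x + (1 - t) *\<^sub>R y) \<le> t * \<phi> x + (1 - t) * \<phi> y"
proof -
  have "f (t *\<^sub>R x + (1 - t) *\<^sub>R y) \<le> ereal t * f x + ereal (1 - t) * f y"
    using cvx assms unfolding convex_fun_def by blast
  then have le: "f (t *\<^sub>R x + (1 - t) *\<^sub>R y) \<le> ereal (t * \<phi> x + (1 - t) * \<phi> y)"
    by (simp add: f_eq assms)
  then show *: "t *\<^sub>R x + (1 - t) *\<^sub>R y \<in> edom f"
    by (auto simp: edom_iff intro: le_less_trans)
  show "\<phi> (t *\<^sub>R x + (1 - t) *\<^sub>R y) \<le> t * \<phi> x + (1 - t) * \<phi> y"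
    using le by (simp add: f_eq[OF *])
qed

lemma convex_edom: "convex (edom f)"
  by (rule convexI) (metis \<phi>_convex(1) add_diff_cancel_left' add_increasing2 order_refl)

lemma convex_U: "convex U"
  using convex_edom by (rule convex_interior)

lemma \<phi>_closed:
  assumes xs: "\<And>k::nat. xs k \<in> edom f" "xs \<longlonglongrightarrow> x" and l: "(\<lambda>k. \<phi> (xs k)) \<longlonglongrightarrow> l"
  shows "x \<in> edom f \<and> \<phi> x \<le> l"
proof -
  have "f x \<le> liminf (\<lambda>k. f (xs k))" using lsc xs(2) by (simp add: lsc_fun_def)
  also have "(\<lambda>k. f (xs k)) = (\<lambda>k. ereal (\<phi> (xs k)))" using xs(1) f_eq by blast
  also have "liminf (\<lambda>k. ereal (\<phi> (xs k))) = ereal l"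
    by (intro lim_imp_Liminf) (use l in auto)
  finally have le: "f x \<le> ereal l" .
  then have *: "x \<in> edom f" by (auto simp: edom_iff intro: le_less_trans)
  with le show ?thesis by (simp add: f_eq)
qed

section \<open>Gateaux gradients and the gradient inequality\<close>

lemma gateaux_grad_grad: "x \<in> U \<Longrightarrow> gateaux_grad f x (grad f x)"
  using leg unfolding legendre_def essentially_smooth_def grad_def by (blast intro: someI_ex)

lemma eventually_in_U:
  assumes "x \<in> U"
  shows "\<forall>\<^sub>F t in at (0::real). x + t *\<^sub>R h \<in> U"
proof -
  have "((\<lambda>t. x + t *\<^sub>R h) \<longlongrightarrow> x + 0 *\<^sub>R h) (at (0::real))" by (intro tendsto_intros)
  then show ?thesis using topological_tendstoD[OF _ open_interior] assms by auto
qed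

lemma \<phi>_gateaux:
  assumes x: "x \<in> U"
  shows "((\<lambda>t. (\<phi> (x + t *\<^sub>R h) - \<phi> x) / t) \<longlongrightarrow> inner (grad f x) h) (at 0)"
proof -
  have "((\<lambda>t. (f (x + t *\<^sub>R h) - f x) / ereal t) \<longlongrightarrow> ereal (inner (grad f x) h)) (at 0)"
    using gateaux_grad_grad[OF x] by (simp add: gateaux_grad_def)
  moreover have "\<forall>\<^sub>F t in at 0. (f (x + t *\<^sub>R h) - f x) / ereal t = ereal ((\<phi> (x + t *\<^sub>R h) - \<phi> x) / t)"
    using eventually_in_U[OF x, of h] eventually_neq_at_within[of 0]
    by eventually_elim (use x in \<open>simp add: f_eq interior_in_edom\<close>)
  ultimately show ?thesis by (subst (asm) tendsto_cong) auto
qed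

lemma \<phi>_gateaux_right:
  assumes x: "x \<in> U"
  shows "((\<lambda>t. (\<phi> (x + t *\<^sub>R h) - \<phi> x) / t) \<longlongrightarrow> inner (grad f x) h) (at_right 0)"
  using \<phi>_gateaux[OF x] by (rule tendsto_mono[rotated]) (simp add: at_le)

text \<open>For \<open>t\<close> in (0,1) convexity bounds the difference quotient towards
  \<open>y\<close> by \<open>\<phi> y - \<phi> x\<close>; let \<open>t\<close> decrease to
  0.\<close>

lemma gradient_ineq:
  assumes x: "x \<in> U" and y: "y \<in> edom f"
  shows "\<phi> x + inner (grad f x) (y - x) \<le> \<phi> y"
proof -
  have "inner (grad f x) (y - x) \<le> \<phi> y - \<phi> x"
  proof (rule tendsto_upperbound[OF \<phi>_gateaux_right[OF x]])
    have "\<forall>\<^sub>F t in at_right 0. t \<in> {0<..<1::real}" by (rule eventually_at_right_real) simp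
    then show "\<forall>\<^sub>F t in at_right 0. (\<phi> (x + t *\<^sub>R (y - x)) - \<phi> x) / t \<le> \<phi> y - \<phi> x"
    proof eventually_elim
      case (elim t)
      have "\<phi> (t *\<^sub>R y + (1 - t) *\<^sub>R x) \<le> t * \<phi> y + (1 - t) * \<phi> x"
        using elim by (intro \<phi>_convex y interior_in_edom x) auto
      also have "t *\<^sub>R y + (1 - t) *\<^sub>R x = x + t *\<^sub>R (y - x)" by (simp add: algebra_simps)
      finally show ?case using elim by (simp add: field_simps)
    qed
  qed simp
  then show ?thesis by simp
qed

lemma subdiffI:
  assumes "x \<in> edom f" "\<And>y. y \<in> edom f \<Longrightarrow> \<phi> x + inner u (y - x) \<le> \<phi> y"
  shows "u \<in> subdiff f x"
proof -
  have "f x + ereal (inner u (y - x)) \<le> f y" for y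
    by (cases "y \<in> edom f") (use assms in \<open>auto simp: f_eq f_outside\<close>)
  then show ?thesis using assms(1) by (simp add: subdiff_def edom_iff)
qed

section \<open>The real-valued Bregman distance\<close>

lemma D_nonneg: "x \<in> edom f \<Longrightarrow> z \<in> U \<Longrightarrow> 0 \<le> D x z"
  using gradient_ineq[of z x] by (simp add: D_def)

lemma D_self [simp]: "D x x = 0"
  by (simp add: D_def)

lemma D_closed:
  assumes xs: "\<And>k::nat. xs k \<in> edom f" "xs \<longlonglongrightarrow> x" and l: "(\<lambda>k. D (xs k) z) \<longlonglongrightarrow> l"
  shows "x \<in> edom f \<and> D x z \<le> l"
proof -
  have "(\<lambda>k. D (xs k) z + \<phi> z + inner (grad f z) (xs k - z)) \<longlonglongrightarrow> l + \<phi> z + inner (grad f z) (x - z)"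
    by (intro tendsto_intros xs l)
  then have "(\<lambda>k. \<phi> (xs k)) \<longlonglongrightarrow> l + \<phi> z + inner (grad f z) (x - z)"
    by (simp add: D_def)
  from \<phi>_closed[OF xs this] show ?thesis by (simp add: D_def)
qed

lemma D_convex:
  assumes "x \<in> edom f" "y \<in> edom f" "0 \<le> t" "t \<le> 1"
  shows "D (t *\<^sub>R x + (1 - t) *\<^sub>R y) z \<le> t * D x z + (1 - t) * D y z"
  using \<phi>_convex(2)[OF assms] unfolding D_def by (simp add: inner_simps algebra_simps)

lemma bregman_eq: "x \<in> edom f \<Longrightarrow> z \<in> U \<Longrightarrow> bregman f x z = ereal (D x z)"
  by (simp add: bregman_def D_def f_eq interior_in_edom)

lemma bregman_outside: "x \<notin> edom f \<Longrightarrow> bregman f x z = \<infinity>"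
  by (simp add: bregman_def f_outside f_eq interior_in_edom)

text \<open>Adding the gradient inequalities from \<open>x\<close> and \<open>y\<close> at their
  midpoint cancels the linear terms when \<open>eq\<close> holds, so the midpoint value is at least
  the average, against strict convexity on \<open>U\<close>.\<close>

lemma gradient_strictly_monotone:
  assumes x: "x \<in> U" and y: "y \<in> U" and eq: "inner (grad f x - grad f y) (x - y) = 0"
  shows "x = y"
proof (rule ccontr)
  assume "x \<noteq> y"
  have "U \<subseteq> dom_subdiff f"
    using leg by (auto simp: legendre_def essentially_smooth_def)
  then have "strictly_convex_on_set U f"
    using leg convex_U by (auto simp: legendre_def essentially_strictly_convex_def)
  then have "\<And>t. x \<noteq> y \<and> 0 < t \<and> t < 1 \<Longrightarrow>
      f (t *\<^sub>R x + (1 - t) *\<^sub>R y) < ereal t * f x + ereal (1 - t) * f y"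
    using x y unfolding strictly_convex_on_set_def by blast
  note lt = this[of "1/2"]
  define q where "q = (1/2) *\<^sub>R x + (1 - 1/2) *\<^sub>R y"
  have q: "q \<in> edom f" unfolding q_def by (intro \<phi>_convex interior_in_edom x y) auto
  have "f q < ereal (1/2) * f x + ereal (1/2) * f y"
    using lt \<open>x \<noteq> y\<close> by (simp add: q_def)
  then have "\<phi> q < (\<phi> x + \<phi> y) / 2"
    using q x y by (simp add: f_eq interior_in_edom)
  moreover have "q - x = (1/2) *\<^sub>R (y - x)" "q - y = (1/2) *\<^sub>R (x - y)"
    by (simp_all add: q_def algebra_simps flip: scaleR_add_left)
  then have "\<phi> x + inner (grad f x) (y - x) / 2 \<le> \<phi> q"
    "\<phi> y + inner (grad f y) (x - y) / 2 \<le> \<phi> q"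
    using gradient_ineq[OF x q] gradient_ineq[OF y q] by simp_all
  moreover have "inner (grad f x) (y - x) + inner (grad f y) (x - y) = 0"
    using eq by (simp add: inner_simps)
  ultimately show False by argo
qed

text \<open>The quadratic term supplies strong midpoint convexity, hence a minimizer. The point of
  interest is the subgradient: it differs from \<open>grad f z\<close> by \<open>w - p\<close>, so
  it is close to \<open>grad f z\<close> whenever \<open>p\<close> is close to
  \<open>w\<close>.\<close>

lemma proximal_point:
  assumes z: "z \<in> U"
  obtains p where "p \<in> edom f"
    "\<And>x. x \<in> edom f \<Longrightarrow> D p z + (norm (p - w))\<^sup>2 / 2 \<le> D x z + (norm (x - w))\<^sup>2 / 2"
    "grad f z + (w - p) \<in> subdiff f p"
proof -
  define G where "G x = D x z + (norm (x - w))\<^sup>2 / 2" for x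
  obtain p where p: "p \<in> edom f" and min: "\<And>x. x \<in> edom f \<Longrightarrow> G p \<le> G x"
  proof (rule minimizer_strongly_midconvex[of "edom f" 0 G])
    show "edom f \<noteq> {}" using z interior_in_edom by blast
    show "0 \<le> G x" if "x \<in> edom f" for x using D_nonneg[OF that z] by (simp add: G_def)
    show "(1/2) *\<^sub>R (x + y) \<in> edom f \<and> G ((1/2) *\<^sub>R (x + y)) \<le> (G x + G y) / 2 - (norm (x - y))\<^sup>2 / 8"
      if xy: "x \<in> edom f" "y \<in> edom f" for x y
      using \<phi>_convex(1)[OF xy, of "1/2"] D_convex[OF xy, of "1/2" z] half_sum_norm_power2[of x y w]
      by (simp add: G_def scaleR_add_right) (simp add: field_simps)
    fix xs :: "nat \<Rightarrow> 'a" and x l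
    assume xs: "\<And>k. xs k \<in> edom f" "xs \<longlonglongrightarrow> x" and l: "(\<lambda>k. G (xs k)) \<longlonglongrightarrow> l"
    have "(\<lambda>k. G (xs k) - (norm (xs k - w))\<^sup>2 / 2) \<longlonglongrightarrow> l - (norm (x - w))\<^sup>2 / 2"
      by (intro tendsto_intros l xs) auto
    then have "(\<lambda>k. D (xs k) z) \<longlonglongrightarrow> l - (norm (x - w))\<^sup>2 / 2" by (simp add: G_def)
    from D_closed[OF xs this] show "x \<in> edom f \<and> G x \<le> l" by (simp add: G_def)
  qed metis
  have "grad f z + (w - p) \<in> subdiff f p"
  proof (rule subdiffI[OF p])
    fix y assume y: "y \<in> edom f"
    define c where "c = (norm (y - p))\<^sup>2 / 2"
    \<comment> \<open>Compare \<open>p\<close> with the point at parameter \<open>t\<close> towards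
      \<open>y\<close> and divide by \<open>t\<close>; the quadratic remainder \<open>t * c\<close>
      then vanishes in the limit.\<close>
    have "0 \<le> D y z - D p z + inner (p - w) (y - p) + t * c" if t: "0 < t" "t < 1" for t
    proof -
      have e: "t *\<^sub>R y + (1 - t) *\<^sub>R p = p + t *\<^sub>R (y - p)" by (simp add: algebra_simps)
      have "G p \<le> G (p + t *\<^sub>R (y - p))"
        using \<phi>_convex(1)[OF y p, of t] t by (intro min) (simp add: e)
      moreover have "D (p + t *\<^sub>R (y - p)) z \<le> t * D y z + (1 - t) * D p z"
        using D_convex[OF y p, of t z] t by (simp add: e)
      moreover have "(norm (p + t *\<^sub>R (y - p) - w))\<^sup>2 / 2
          = (norm (p - w))\<^sup>2 / 2 + t * inner (p - w) (y - p) + t\<^sup>2 * c"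
        unfolding c_def power2_norm_eq_inner
        by (simp add: inner_simps inner_commute) (simp add: field_simps power2_eq_square)
      ultimately have "0 \<le> t * D y z - t * D p z + t * inner (p - w) (y - p) + t\<^sup>2 * c"
        unfolding G_def left_diff_distrib mult_1 by argo
      also have "\<dots> = t * (D y z - D p z + inner (p - w) (y - p) + t * c)"
        by (simp add: distrib_left right_diff_distrib power2_eq_square)
      finally show ?thesis using t(1) by (simp only: zero_le_mult_iff) simp
    qed
    then have "\<forall>\<^sub>F t in at_right 0. 0 \<le> D y z - D p z + inner (p - w) (y - p) + t * c"
      by (intro eventually_mono[OF eventually_at_right_real[of 0 1]]) simp_all
    moreover have "((\<lambda>t. D y z - D p z + inner (p - w) (y - p) + t * c)
        \<longlongrightarrow> D y z - D p z + inner (p - w) (y - p) + 0 * c) (at_right 0)"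
      by (intro tendsto_intros)
    ultimately have "0 \<le> D y z - D p z + inner (p - w) (y - p) + 0 * c"
      by (intro tendsto_lowerbound[OF _ _ trivial_limit_at_right_real])
    then show "\<phi> p + inner (grad f z + (w - p)) (y - p) \<le> \<phi> y"
      by (simp add: D_def inner_simps)
  qed
  with p min[unfolded G_def] show ?thesis by (rule that)
qed

text \<open>A point far from \<open>z\<close> with small Bregman distance produces, by convexity along the segment to
  \<open>z\<close>, a point \<open>w\<close> at fixed distance \<open>s\<close> whose value is arbitrarily small. The proximal point of
  \<open>w\<close> is then close to \<open>w\<close> and carries a subgradient close to \<open>\<nabla>f(z)\<close>, against local boundedness
  of the inverse subdifferential.\<close>

lemma D_coercive:
  assumes z: "z \<in> U"
  shows "bounded {x \<in> edom f. D x z \<le> c}"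
proof -
  have "grad f z \<in> subdiff f z"
    using gradient_ineq[OF z] z by (intro subdiffI interior_in_edom)
  then obtain \<delta> where \<delta>: "\<delta> > 0" "bounded {x. \<exists>v\<in>subdiff f x. dist v (grad f z) < \<delta>}"
    using leg unfolding legendre_def essentially_strictly_convex_def inv_subdiff_locally_bounded_def
    by blast
  then obtain R where R: "R > 0" "\<And>x v. v \<in> subdiff f x \<Longrightarrow> dist v (grad f z) < \<delta> \<Longrightarrow> norm x \<le> R"
    by (auto simp: bounded_pos)
  \<comment> \<open>With \<open>norm (w - z) = s\<close>, the estimates
    \<open>norm p \<le> R\<close> and \<open>norm (p - w) < 1\<close> would give
    \<open>s < R + norm z + 1\<close>, a contradiction.\<close>
  define s where "s = R + norm z + 2"
  define d where "d = min 1 (\<delta>\<^sup>2)"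
  have s: "s > 0" using R(1) by (simp add: s_def add_pos_nonneg)
  have d: "d > 0" using \<delta>(1) by (simp add: d_def)
  \<comment> \<open>Beyond the first bound, \<open>w\<close> lies on the segment from
    \<open>z\<close> to \<open>x\<close>; beyond the second,
    \<open>2 * (s / r) * \<bar>c\<bar> < d\<close>, which puts \<open>p\<close> within both
    \<open>\<delta>\<close> and 1 of \<open>w\<close>.\<close>
  have "norm (x - z) \<le> max s (2 * \<bar>c\<bar> * s / d)" if x: "x \<in> edom f" "D x z \<le> c" for x
  proof (rule ccontr)
    define r where "r = norm (x - z)"
    assume "\<not> norm (x - z) \<le> max s (2 * \<bar>c\<bar> * s / d)"
    then have rs: "s < r" and rd: "2 * \<bar>c\<bar> * s / d < r" by (auto simp: r_def)
    have r0: "r > 0" using s rs by simp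
    define w where "w = (s / r) *\<^sub>R x + (1 - s / r) *\<^sub>R z"
    have zE: "z \<in> edom f" using z by (rule interior_in_edom)
    have w: "w \<in> edom f" "D w z \<le> s / r * D x z"
      using \<phi>_convex(1)[OF x(1) zE, of "s / r"] D_convex[OF x(1) zE, of "s / r" z] s rs r0
      by (auto simp: w_def)
    obtain p where p: "p \<in> edom f"
      "\<And>x. x \<in> edom f \<Longrightarrow> D p z + (norm (p - w))\<^sup>2 / 2 \<le> D x z + (norm (x - w))\<^sup>2 / 2"
      "grad f z + (w - p) \<in> subdiff f p"
      using proximal_point[OF z, of w] by metis
    have "(norm (p - w))\<^sup>2 \<le> 2 * (s / r * D x z)"
      using p(2)[OF w(1)] w(2) D_nonneg[OF p(1) z] by simp
    also have "\<dots> \<le> 2 * (s / r * \<bar>c\<bar>)"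
      using x(2) s r0 by (intro mult_left_mono) auto
    also have "\<dots> < d" using rd r0 d by (simp add: field_simps)
    finally have lt: "(norm (p - w))\<^sup>2 < d" .
    have "norm (p - w) < \<delta>"
      by (rule power_less_imp_less_base[of _ 2]) (use lt \<delta>(1) in \<open>simp_all add: d_def\<close>)
    moreover have "norm (p - w) < 1"
      by (rule power_less_imp_less_base[of _ 2]) (use lt in \<open>simp_all add: d_def\<close>)
    ultimately have "norm p \<le> R" using R(2)[OF p(3)] by (simp add: dist_norm norm_minus_commute)
    have "w - z = (s / r) *\<^sub>R (x - z)" by (simp add: w_def algebra_simps)
    then have "norm (w - z) = s" using r0 s by (simp add: r_def)
    then have "s \<le> norm (p - w) + norm p + norm z"
      using norm_triangle_ineq4[of w z] norm_triangle_sub[of w p] by (simp add: norm_minus_commute)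
    with \<open>norm p \<le> R\<close> \<open>norm (p - w) < 1\<close> show False by (simp add: s_def)
  qed
  then have "{x \<in> edom f. D x z \<le> c} \<subseteq> cball z (max s (2 * \<bar>c\<bar> * s / d))"
    by (auto simp: dist_norm norm_minus_commute)
  then show ?thesis by (rule bounded_subset[OF bounded_cball])
qed

section \<open>Minimizers over affine sets: existence, interiority, optimality\<close>

lemma locally_bounded_above:
  assumes y: "y \<in> U"
  obtains r B where "r > 0" "\<And>x. norm (x - y) < r \<Longrightarrow> x \<in> edom f \<and> \<phi> x \<le> B"
proof -
  obtain e where e: "e > 0" "cball y e \<subseteq> edom f"
    using y by (auto simp: mem_interior_cball)
  \<comment> \<open>Baire argument: lower semicontinuity makes these sublevel sets closed, and they
    cover a ball around \<open>y\<close>, so one of them contains a ball.\<close>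
  define C where "C n = {x \<in> cball y e. \<phi> x \<le> real n}" for n
  have "closed (C n)" for n
  proof (clarsimp simp: closed_sequential_limits)
    fix xs x assume xs: "\<forall>k. xs k \<in> C n" "xs \<longlonglongrightarrow> x"
    have xC: "x \<in> cball y e"
      using xs closed_cball[of y e] unfolding closed_sequential_limits C_def by blast
    have "f x \<le> liminf (\<lambda>k. f (xs k))" using lsc xs(2) by (simp add: lsc_fun_def)
    also have "\<dots> \<le> liminf (\<lambda>k::nat. ereal (real n))"
      using xs(1) e(2) by (intro Liminf_mono always_eventually) (auto simp: C_def f_eq subset_iff)
    also have "\<dots> = ereal (real n)" by (simp add: Liminf_const)
    finally show "x \<in> C n" using xC e(2) by (auto simp: C_def f_eq subset_iff)
  qed
  moreover have "y \<in> interior (\<Union>n. C n)"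
  proof -
    have "x \<in> (\<Union>n. C n)" if "x \<in> ball y e" for x
      using that real_arch_simple[of "\<phi> x"] by (simp add: C_def)
    then show ?thesis using e(1) by (auto simp: mem_interior)
  qed
  moreover have "interior (\<Union>n. C n) = {}" if "\<And>n. closed (C n)" "\<And>n. interior (C n) = {}"
    using Baire_category_alt[of "euclidean :: 'a topology" "range C"] that
      completely_metrizable_space_euclidean by (auto simp flip: closed_closedin)
  ultimately obtain n where "interior (C n) \<noteq> {}"
    by (metis empty_iff)
  then obtain a \<rho> where a: "\<rho> > 0" "ball a \<rho> \<subseteq> C n"
    by (auto simp: mem_interior)
  \<comment> \<open>The reflection of \<open>a\<close> through \<open>y\<close>. Averaging the ball
    around \<open>a\<close> with \<open>b\<close> moves the upper bound to a ball of half the radius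
    around \<open>y\<close>.\<close>
  define b where "b = y + (y - a)"
  have "a \<in> cball y e" using a by (auto simp: C_def subset_iff)
  then have "b \<in> cball y e" by (simp add: b_def dist_norm norm_minus_commute)
  then have b: "b \<in> edom f" using e(2) by blast
  have "x \<in> edom f \<and> \<phi> x \<le> real n / 2 + \<phi> b / 2" if x: "norm (x - y) < \<rho> / 2" for x
  proof -
    define c where "c = a + 2 *\<^sub>R (x - y)"
    have "c \<in> ball a \<rho>" using x by (simp add: c_def dist_norm)
    then have "c \<in> C n" using a(2) by blast
    then have c: "c \<in> edom f" "\<phi> c \<le> real n" using e(2) by (auto simp: C_def)
    have "(1/2) *\<^sub>R c + (1 - 1/2) *\<^sub>R b = x"
      by (simp add: c_def b_def algebra_simps flip: scaleR_add_left)
    then show ?thesis using \<phi>_convex[OF c(1) b, of "1/2"] c(2) by simp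
  qed
  moreover have "0 < \<rho> / 2" using a(1) by simp
  ultimately show ?thesis by (intro that)
qed

text \<open>The homothety with centre \<open>p\<close> and ratio \<open>t\<close> carries a ball
  around \<open>y\<close> inside \<open>edom f\<close> to a ball that convexity keeps inside
  \<open>edom f\<close>.\<close>

lemma segment_in_U:
  assumes y: "y \<in> U" and p: "p \<in> edom f" and t: "0 < t" "t \<le> 1"
  shows "p + t *\<^sub>R (y - p) \<in> U"
proof -
  obtain r where r: "r > 0" "ball y r \<subseteq> edom f" using y by (auto simp: mem_interior)
  have "ball (p + t *\<^sub>R (y - p)) (t * r) \<subseteq> edom f"
  proof
    fix x assume x: "x \<in> ball (p + t *\<^sub>R (y - p)) (t * r)"
    define h where "h = (1/t) *\<^sub>R (x - (p + t *\<^sub>R (y - p)))"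
    have "norm (x - (p + t *\<^sub>R (y - p))) < t * r" using x by (simp add: dist_norm norm_minus_commute)
    then have "norm h < r" using t by (simp only: h_def norm_scaleR) (simp add: field_simps)
    then have "y + h \<in> edom f" using r(2) by (auto simp: dist_norm subset_iff)
    moreover have "t *\<^sub>R (y + h) + (1 - t) *\<^sub>R p = x"
      using t by (simp add: h_def algebra_simps)
    ultimately show "x \<in> edom f" using \<phi>_convex(1)[of "y + h" p t] p t by simp
  qed
  then show ?thesis using r t by (auto simp: mem_interior intro!: exI[of _ "t * r"])
qed

text \<open>If \<open>p\<close> were a boundary point, the gradients along the segment from \<open>p\<close> to \<open>y\<close> would blow up.
  They are subgradients, \<open>\<phi>\<close> is bounded above near \<open>y\<close>, and minimality bounds their component
  along \<open>y - p\<close> from below, so they are in fact bounded.\<close>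

lemma minimizer_in_interior:
  assumes A: "affine A" and y: "y \<in> A" "y \<in> U" and z: "z \<in> U" and p: "p \<in> A" "p \<in> edom f"
    and min: "\<And>x. x \<in> A \<Longrightarrow> x \<in> edom f \<Longrightarrow> D p z \<le> D x z"
  shows "p \<in> U"
proof (rule ccontr)
  assume "p \<notin> U"
  then have fr: "p \<in> frontier (edom f)"
    using p(2) closure_subset by (auto simp: frontier_def)
  define t where "t k = inverse (real (Suc (k + 1)))" for k
  define x where "x k = p + t k *\<^sub>R (y - p)" for k
  have t: "0 < t k" "t k \<le> 1/2" for k by (auto simp: t_def field_simps)
  have "t \<longlonglongrightarrow> 0"
    unfolding t_def[abs_def] by (rule LIMSEQ_ignore_initial_segment[OF LIMSEQ_inverse_real_of_nat])
  then have "x \<longlonglongrightarrow> p + 0 *\<^sub>R (y - p)" unfolding x_def[abs_def] by (intro tendsto_intros)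
  then have xp: "x \<longlonglongrightarrow> p" by simp
  have xU: "x k \<in> U" for k
    unfolding x_def using t[of k] by (intro segment_in_U y p) auto
  have xA: "x k \<in> A" for k
    using mem_affine[OF A p(1) y(1), of "1 - t k" "t k"] by (simp add: x_def algebra_simps)
  have lim: "filterlim (\<lambda>k. norm (grad f (x k))) at_top sequentially"
    using leg xU xp fr unfolding legendre_def essentially_smooth_def by blast
  obtain r B where rB: "r > 0" "\<And>x. norm (x - y) < r \<Longrightarrow> x \<in> edom f \<and> \<phi> x \<le> B"
    using locally_bounded_above[OF y(2)] by blast
  define K where "K = \<bar>B\<bar> + \<bar>\<phi> p\<bar> + 2 * \<bar>inner (grad f z) (y - p)\<bar>"
  have "norm (grad f (x k)) \<le> 2 * K / r" for k
  proof -
    let ?g = "grad f (x k)"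
    have min': "\<phi> p + t k * inner (grad f z) (y - p) \<le> \<phi> (x k)"
      using min[OF xA interior_in_edom[OF xU], of k] by (simp add: D_def x_def inner_simps algebra_simps)
    have "\<phi> (x k) + inner ?g (p - x k) \<le> \<phi> p" by (intro gradient_ineq xU p)
    then have "t k * inner (grad f z) (y - p) \<le> t k * inner ?g (y - p)"
      using min' by (simp add: x_def inner_simps algebra_simps)
    \<comment> \<open>Minimality at \<open>p\<close> bounds \<open>\<phi> (x k)\<close> from below,
      the gradient inequality from \<open>x k\<close> back to \<open>p\<close> bounds it from above;
      the common factor \<open>t k\<close> cancels.\<close>
    then have dir: "inner (grad f z) (y - p) \<le> inner ?g (y - p)"
      using t(1) by simp
    \<comment> \<open>A step along the gradient, short enough to stay where \<open>\<phi>\<close> is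
      at most \<open>B\<close>, so that its inner product with the gradient is a multiple of the
      gradient norm.\<close>
    define h where "h = (r / 2) *\<^sub>R sgn ?g"
    have "norm h < r" using rB(1) by (simp add: h_def norm_sgn)
    then have yh: "y + h \<in> edom f" "\<phi> (y + h) \<le> B" using rB(2)[of "y + h"] by auto
    have gh: "inner ?g h = r / 2 * norm ?g"
      by (cases "?g = 0") (simp_all add: h_def sgn_div_norm power2_norm_eq_inner[symmetric] power2_eq_square)
    have "\<phi> (x k) + inner ?g (y + h - x k) \<le> B"
      using gradient_ineq[OF xU yh(1), of k] yh(2) by simp
    moreover have "y + h - x k = (1 - t k) *\<^sub>R (y - p) + h"
      by (simp add: x_def algebra_simps)
    then have "inner ?g (y + h - x k) = (1 - t k) * inner ?g (y - p) + r / 2 * norm ?g"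
      by (simp only: inner_add_right inner_scaleR_right gh)
    moreover have "(1 - t k) * inner (grad f z) (y - p) \<le> (1 - t k) * inner ?g (y - p)"
      using t[of k] dir by (intro mult_left_mono) auto
    \<comment> \<open>The weights \<open>t k\<close> from \<open>min'\<close> and
      \<open>1 - t k\<close> from \<open>dir\<close> add up to 1, which makes the bound independent
      of \<open>k\<close>.\<close>
    ultimately have "r / 2 * norm ?g \<le> B - \<phi> p - inner (grad f z) (y - p)"
      using min' by (simp add: algebra_simps)
    also have "\<dots> \<le> K" unfolding K_def by linarith
    finally show ?thesis using rB(1) by (simp add: field_simps)
  qed
  then have "\<not> (2 * K / r < norm (grad f (x k)))" for k by (simp add: not_less)
  moreover have "\<forall>\<^sub>F k in sequentially. 2 * K / r < norm (grad f (x k))"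
    using lim unfolding filterlim_at_top_dense by blast
  ultimately show False by simp
qed

text \<open>Moving from \<open>p\<close> along \<open>a - b\<close> stays in \<open>A\<close>, so
  minimality bounds the right directional derivative of \<open>\<phi>\<close> below; exchanging
  \<open>a\<close> and \<open>b\<close> gives equality.\<close>

lemma minimizer_optimality:
  assumes A: "affine A" and z: "z \<in> U" and p: "p \<in> A" "p \<in> U"
    and min: "\<And>x. x \<in> A \<Longrightarrow> x \<in> edom f \<Longrightarrow> D p z \<le> D x z"
    and ab: "a \<in> A" "b \<in> A"
  shows "inner (grad f p - grad f z) (a - b) = 0"
proof -
  have le: "inner (grad f z) (a - b) \<le> inner (grad f p) (a - b)" if ab: "a \<in> A" "b \<in> A" for a b
  proof (rule tendsto_lowerbound[OF \<phi>_gateaux_right[OF p(2)]])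
    have "\<forall>\<^sub>F t in at_right 0. p + t *\<^sub>R (a - b) \<in> U"
      using eventually_in_U[OF p(2)] by (rule filter_leD[rotated]) (simp add: at_le)
    moreover have "\<forall>\<^sub>F t in at_right (0::real). 0 < t" by (simp add: eventually_at_right_less)
    ultimately show "\<forall>\<^sub>F t in at_right 0. inner (grad f z) (a - b) \<le> (\<phi> (p + t *\<^sub>R (a - b)) - \<phi> p) / t"
    proof eventually_elim
      case (elim t)
      have "p + t *\<^sub>R (a - b) \<in> A" using mem_affine_3_minus[OF A p(1) ab] .
      from min[OF this interior_in_edom[OF elim(1)]] elim(2) show ?case
        by (simp add: D_def inner_simps field_simps)
    qed
  qed simp
  show ?thesis using le[OF ab] le[OF ab(2,1)] by (simp add: inner_simps)
qed

text \<open>Coercivity bounds a minimizing sequence. Finite dimension then gives norm convergence of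
  a subsequence, the mode in which lower semicontinuity of \<open>f\<close> is available.\<close>

lemma minimizer_exists:
  assumes S: "finite S" and y: "y \<in> affine hull S" "y \<in> U" and z: "z \<in> U"
  obtains p where "p \<in> affine hull S" "p \<in> edom f"
    "\<And>x. x \<in> affine hull S \<Longrightarrow> x \<in> edom f \<Longrightarrow> D p z \<le> D x z"
proof -
  define E where "E = affine hull S \<inter> edom f"
  define i where "i = (INF x\<in>E. D x z)"
  have yE: "y \<in> E" using y interior_in_edom by (simp add: E_def)
  have bb: "bdd_below ((\<lambda>x. D x z) ` E)"
    by (rule bdd_belowI2[of _ 0]) (simp add: E_def D_nonneg z)
  have i_le: "i \<le> D x z" if "x \<in> E" for x
    unfolding i_def using bb that by (rule cINF_lower)
  have "\<exists>x\<in>E. D x z < i + inverse (real (Suc k))" for k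
    using cInf_lessD[of "(\<lambda>x. D x z) ` E" "i + inverse (real (Suc k))"] yE by (force simp: i_def)
  then obtain xs where xs: "\<And>k. xs k \<in> E" "\<And>k. D (xs k) z < i + inverse (real (Suc k))"
    by metis
  have lim: "(\<lambda>k. D (xs k) z) \<longlonglongrightarrow> i"
  proof (rule tendsto_sandwich[OF _ _ tendsto_const])
    show "(\<lambda>k. i + inverse (real (Suc k))) \<longlonglongrightarrow> i"
      using tendsto_add[OF tendsto_const[of i] LIMSEQ_inverse_real_of_nat]
      by simp
  qed (use xs i_le in \<open>auto intro!: always_eventually less_imp_le\<close>)
  have "D (xs k) z \<le> i + 1" for k
  proof -
    have "inverse (real (Suc k)) \<le> 1" by (simp add: inverse_le_1_iff)
    then show ?thesis using xs(2)[of k] by linarith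
  qed
  then have bd: "bounded (range xs)"
    using xs(1) by (intro bounded_subset[OF D_coercive[OF z, of "i + 1"]]) (auto simp: E_def)
  obtain r p where r: "strict_mono r" "p \<in> affine hull S" "(xs \<circ> r) \<longlonglongrightarrow> p"
    using bounded_seq_affine_hull_convergent_subseq[OF S _ bd] xs(1) by (auto simp: E_def)
  have "(\<lambda>k. D ((xs \<circ> r) k) z) \<longlonglongrightarrow> i"
    using LIMSEQ_subseq_LIMSEQ[OF lim r(1)] by (simp add: o_def)
  from D_closed[OF _ r(3) this] xs(1) have "p \<in> edom f" "D p z \<le> i" by (auto simp: E_def)
  moreover from this(2) have "D p z \<le> D x z" if "x \<in> affine hull S" "x \<in> edom f" for x
    using that i_le[of x] by (simp add: E_def)
  ultimately show ?thesis using r(2) by (intro that)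
qed

text \<open>Competitors outside \<open>edom f\<close> have infinite distance, so only those in the
  domain matter.\<close>

lemma bwd_proj_iff:
  assumes z: "z \<in> U"
  shows "p \<in> bwd_proj f A z \<longleftrightarrow> p \<in> A \<and> p \<in> edom f \<and> (\<forall>x. x \<in> A \<longrightarrow> x \<in> edom f \<longrightarrow> D p z \<le> D x z)"
proof -
  have "bregman f p z \<le> bregman f x z \<longleftrightarrow> (x \<in> edom f \<longrightarrow> D p z \<le> D x z)" if "p \<in> edom f" for x
    using that z by (cases "x \<in> edom f") (auto simp: bregman_eq bregman_outside)
  then show ?thesis by (auto simp: bwd_proj_def)
qed

end

section \<open>Circumcenter iterations\<close>

locale bregman_circumcenter = legendre_function f
  for f :: "'a::{real_inner,complete_space} \<Rightarrow> ereal" +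
  fixes T :: "nat \<Rightarrow> 'a \<Rightarrow> 'a" and m :: nat and F :: "'a set"
  assumes F_def: "F = U \<inter> (\<Inter>i\<in>{1..m}. Fix (T i))"
    and F_ne: "F \<noteq> {}"
    and iso: "\<And>i. i \<in> {1..m} \<Longrightarrow> bregman_isometric f (T i)"
    and unique: "\<And>u v w. u \<in> U \<Longrightarrow> v \<in> fwd_cc_set f m T u \<Longrightarrow> w \<in> fwd_cc_set f m T u \<Longrightarrow> v = w"
begin

abbreviation CC :: "'a \<Rightarrow> 'a" where "CC \<equiv> fwd_cc f m T"

abbreviation aff_S :: "'a \<Rightarrow> 'a set" where "aff_S y \<equiv> affine hull (Sset m T y)"

lemma F_U: "z \<in> F \<Longrightarrow> z \<in> U"
  by (simp add: F_def)

lemma T_in_U: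
  assumes "i \<in> {1..m}" "y \<in> U"
  shows "T i y \<in> U"
  using iso[OF assms(1)] assms(2) interior_in_edom[OF assms(2)] unfolding bregman_isometric_def by blast

lemma bregman_T:
  assumes i: "i \<in> {1..m}" and x: "x \<in> edom f" and z: "z \<in> F"
  shows "T i x \<in> edom f" and "bregman f (T i x) z = bregman f x z"
proof -
  have "T i z = z" using i z by (auto simp: F_def Fix_def)
  then show "T i x \<in> edom f" "bregman f (T i x) z = bregman f x z"
    using iso[OF i] x F_U[OF z] unfolding bregman_isometric_def by metis+
qed

lemma D_T:
  assumes "i \<in> {1..m}" "x \<in> edom f" "z \<in> F"
  shows "D (T i x) z = D x z"
  using bregman_T[OF assms] by (simp add: bregman_eq assms F_U)

lemma Sset_subset_U: "y \<in> U \<Longrightarrow> Sset m T y \<subseteq> U"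
  using T_in_U by (auto simp: Sset_def)

lemma self_in_aff: "y \<in> aff_S y"
  by (intro hull_inc) (simp add: Sset_def)

lemma T_in_aff: "i \<in> {1..m} \<Longrightarrow> T i y \<in> aff_S y"
  by (intro hull_inc) (simp add: Sset_def)

lemma fwd_cc_set_iff:
  assumes y: "y \<in> U"
  shows "v \<in> fwd_cc_set f m T y \<longleftrightarrow> v \<in> aff_S y \<and> v \<in> U \<and> (\<forall>i\<in>{1..m}. D (T i y) v = D y v)"
proof -
  have "Sset m T y \<subseteq> edom f" using Sset_subset_U[OF y] interior_subset by blast
  then show ?thesis
    by (auto simp: fwd_cc_set_def bregman_eq interior_in_edom y T_in_U)
qed

lemma bwd_proj_optimality:
  assumes y: "y \<in> U" and z: "z \<in> F" and p: "p \<in> bwd_proj f (aff_S y) z"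
  shows "p \<in> aff_S y" "p \<in> U"
    and "a \<in> aff_S y \<Longrightarrow> b \<in> aff_S y \<Longrightarrow> inner (grad f p - grad f z) (a - b) = 0"
proof -
  have p: "p \<in> aff_S y" "p \<in> edom f"
    "\<And>x. x \<in> aff_S y \<Longrightarrow> x \<in> edom f \<Longrightarrow> D p z \<le> D x z"
    using p by (auto simp: bwd_proj_iff F_U z)
  show "p \<in> aff_S y" by (fact p)
  show pU: "p \<in> U"
    using minimizer_in_interior[OF affine_affine_hull self_in_aff y F_U[OF z] p] .
  show "inner (grad f p - grad f z) (a - b) = 0" if "a \<in> aff_S y" "b \<in> aff_S y"
    using minimizer_optimality[OF affine_affine_hull F_U[OF z] p(1) pU p(3) that] .
qed

text \<open>Orthogonality of \<open>\<nabla>f(p) - \<nabla>f(z)\<close> to the directions of the affine hull makes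
  \<open>x \<mapsto> D x p - D x z\<close> constant there, and by isometry \<open>D x z\<close> takes the same value at all
  points of \<open>Sset m T y\<close>.\<close>

lemma bwd_proj_subset_fwd_cc_set:
  assumes y: "y \<in> U" and z: "z \<in> F"
  shows "bwd_proj f (aff_S y) z \<subseteq> fwd_cc_set f m T y"
proof
  fix p assume p: "p \<in> bwd_proj f (aff_S y) z"
  note opt = bwd_proj_optimality[OF y z p]
  have "D (T i y) p = D y p" if i: "i \<in> {1..m}" for i
  proof -
    have "inner (grad f p - grad f z) (T i y - y) = 0"
      by (intro opt(3) T_in_aff self_in_aff i)
    with D_T[OF i interior_in_edom[OF y] z] show ?thesis
      by (simp add: D_def inner_simps)
  qed
  with opt show "p \<in> fwd_cc_set f m T y" by (simp add: fwd_cc_set_iff y)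
qed

text \<open>A nonempty projection contained in a set with at most one point forces both to be the
  same singleton, whichever \<open>z\<close> in \<open>F\<close> is projected.\<close>

lemma circumcenter:
  assumes y: "y \<in> U"
  shows CC_U: "CC y \<in> U" and fwd_cc_set_eq: "fwd_cc_set f m T y = {CC y}"
    and bwd_proj_eq: "z \<in> F \<Longrightarrow> bwd_proj f (aff_S y) z = {CC y}"
proof -
  have fin: "finite (Sset m T y)" by (simp add: Sset_def)
  have ne: "bwd_proj f (aff_S y) z \<noteq> {}" if z: "z \<in> F" for z
  proof -
    obtain p where "p \<in> aff_S y" "p \<in> edom f"
      "\<And>x. x \<in> aff_S y \<Longrightarrow> x \<in> edom f \<Longrightarrow> D p z \<le> D x z"
      using minimizer_exists[OF fin self_in_aff y F_U[OF z]] by metis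
    then have "p \<in> bwd_proj f (aff_S y) z" by (simp add: bwd_proj_iff F_U z)
    then show ?thesis by blast
  qed
  have sub: "bwd_proj f (aff_S y) z \<subseteq> fwd_cc_set f m T y" if "z \<in> F" for z
    using bwd_proj_subset_fwd_cc_set[OF y that] .
  obtain w where "w \<in> F" using F_ne by blast
  then obtain p where p: "p \<in> fwd_cc_set f m T y" using ne sub by blast
  then have eq: "fwd_cc_set f m T y = {p}" using unique[OF y] by blast
  then have CC: "CC y = p" by (simp add: fwd_cc_def)
  show "fwd_cc_set f m T y = {CC y}" by (simp add: eq CC)
  show "CC y \<in> U" using p by (simp add: CC fwd_cc_set_iff y)
  show "bwd_proj f (aff_S y) z = {CC y}" if "z \<in> F"
    using ne[OF that] sub[OF that] by (simp add: eq CC subset_singleton_iff)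
qed

text \<open>In the three-point identity for \<open>D\<close> the cross term is the inner product of
  \<open>grad f (CC y) - grad f z\<close> with \<open>y - CC y\<close>, a direction of the affine
  hull, so it vanishes.\<close>

lemma CC_pythagoras:
  assumes y: "y \<in> U" and z: "z \<in> F"
  shows "D y z = D y (CC y) + D (CC y) z"
proof -
  have p: "CC y \<in> bwd_proj f (aff_S y) z" by (simp add: bwd_proj_eq y z)
  from bwd_proj_optimality[OF y z p] self_in_aff
  have "inner (grad f (CC y) - grad f z) (y - CC y) = 0" by blast
  then show ?thesis by (simp add: D_def inner_simps)
qed

lemma CC_equidistant:
  assumes "y \<in> U" "i \<in> {1..m}"
  shows "bregman f (T i y) (CC y) = bregman f y (CC y)"
  using fwd_cc_set_iff[OF assms(1), of "CC y"] assms
  by (simp add: fwd_cc_set_eq bregman_eq interior_in_edom T_in_U)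

text \<open>At a common fixed point all members of \<open>Sset m T x\<close> coincide, so
  \<open>x\<close> is trivially equidistant and uniqueness applies.\<close>

lemma CC_fixed:
  assumes x: "x \<in> F"
  shows "CC x = x"
proof -
  have xU: "x \<in> U" using x by (rule F_U)
  have "T i x = x" if "i \<in> {1..m}" for i using x that by (auto simp: F_def Fix_def)
  then have "x \<in> fwd_cc_set f m T x"
    by (simp add: fwd_cc_set_iff[OF xU] xU self_in_aff)
  then show ?thesis by (simp add: fwd_cc_set_eq[OF xU])
qed

section \<open>Iterates: monotonicity and asymptotic regularity\<close>

lemma iterate_U: "y \<in> U \<Longrightarrow> (CC ^^ k) y \<in> U"
  by (induction k) (simp_all add: CC_U)

lemma iterate_D_Suc_le:
  assumes y: "y \<in> U" and z: "z \<in> F"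
  shows "D ((CC ^^ Suc k) y) z \<le> D ((CC ^^ k) y) z"
  using CC_pythagoras[OF iterate_U[OF y] z, of k]
    D_nonneg[OF interior_in_edom[OF iterate_U[OF y]] iterate_U[OF y], of k "Suc k"] by simp

lemma iterate_D_convergent:
  assumes y: "y \<in> U" and z: "z \<in> F"
  obtains L where "(\<lambda>k. D ((CC ^^ k) y) z) \<longlonglongrightarrow> L"
proof -
  have "decseq (\<lambda>k. D ((CC ^^ k) y) z)"
    using iterate_D_Suc_le[OF y z] by (rule decseq_SucI)
  moreover have "0 \<le> D ((CC ^^ k) y) z" for k
    by (intro D_nonneg interior_in_edom iterate_U y F_U z)
  ultimately show ?thesis using decseq_convergent that by metis
qed

lemma iterate_D_le:
  assumes y: "y \<in> U" and z: "z \<in> F"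
  shows "D ((CC ^^ k) y) z \<le> D y z"
proof (induction k)
  case (Suc k)
  then show ?case using iterate_D_Suc_le[OF y z, of k] by linarith
qed simp

text \<open>By the Pythagorean identity these distances are consecutive differences of the
  convergent sequence of distances to a point of \<open>F\<close>.\<close>

lemma iterate_asymptotically_regular:
  assumes y: "y \<in> U"
  shows "(\<lambda>k. bregman f ((CC ^^ k) y) ((CC ^^ Suc k) y)) \<longlonglongrightarrow> 0"
proof -
  obtain z where z: "z \<in> F" using F_ne by blast
  obtain L where L: "(\<lambda>k. D ((CC ^^ k) y) z) \<longlonglongrightarrow> L"
    using iterate_D_convergent[OF y z] by blast
  have "(\<lambda>k. D ((CC ^^ k) y) z - D ((CC ^^ Suc k) y) z) \<longlonglongrightarrow> L - L"
    by (intro tendsto_diff L LIMSEQ_Suc[OF L])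
  moreover have "D ((CC ^^ k) y) z - D ((CC ^^ Suc k) y) z = D ((CC ^^ k) y) ((CC ^^ Suc k) y)" for k
    using CC_pythagoras[OF iterate_U[OF y] z, of k] by simp
  ultimately have "(\<lambda>k. D ((CC ^^ k) y) ((CC ^^ Suc k) y)) \<longlonglongrightarrow> 0" by simp
  then have "(\<lambda>k. ereal (D ((CC ^^ k) y) ((CC ^^ Suc k) y))) \<longlonglongrightarrow> ereal 0"
    by (simp only: tendsto_ereal)
  then show ?thesis
    by (simp only: bregman_eq[OF interior_in_edom[OF iterate_U[OF y]] iterate_U[OF y]] zero_ereal_def)
qed

lemma iterate_monotone:
  assumes y: "y \<in> U"
  shows "fwd_bregman_monotone f (\<Inter>i\<in>{1..m}. Fix (T i)) (\<lambda>k. (CC ^^ k) y)"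
  unfolding fwd_bregman_monotone_def
proof (intro conjI ballI allI)
  show "(\<Inter>i\<in>{1..m}. Fix (T i)) \<inter> U \<noteq> {}" using F_ne by (simp add: F_def Int_commute)
  show "(CC ^^ k) y \<in> U" for k by (rule iterate_U[OF y])
  fix c k assume "c \<in> (\<Inter>i\<in>{1..m}. Fix (T i)) \<inter> U"
  then have c: "c \<in> F" by (simp add: F_def)
  \<comment> \<open>The next iterate minimizes the distance to \<open>c\<close> over an affine hull
    that contains the current iterate.\<close>
  have "CC ((CC ^^ k) y) \<in> bwd_proj f (aff_S ((CC ^^ k) y)) c"
    by (simp add: bwd_proj_eq iterate_U y c)
  then show "bregman f ((CC ^^ Suc k) y) c \<le> bregman f ((CC ^^ k) y) c"
    using self_in_aff by (auto simp: bwd_proj_def)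
qed

section \<open>Demiclosedness and weak convergence\<close>

context
  assumes demiclosed: "\<And>i. i \<in> {1..m} \<Longrightarrow> f_demiclosed f UNIV (T i)"
    and transfer: "\<And>u i. (\<And>k. u k \<in> U) \<Longrightarrow> (\<lambda>k. bregman f (u k) (CC (u k))) \<longlonglongrightarrow> 0 \<Longrightarrow>
      (\<And>j. j \<in> {1..m} \<Longrightarrow> (\<lambda>k. bregman f (T j (u k)) (CC (u k))) \<longlonglongrightarrow> 0) \<Longrightarrow> i \<in> {1..m} \<Longrightarrow>
      (\<lambda>k. bregman f (u k) (T i (u k))) \<longlonglongrightarrow> 0"
begin

text \<open>Equidistance copies \<open>lim\<close> to every \<open>T j (u k)\<close>, which meets
  the premises of \<open>transfer\<close>; demiclosedness of each \<open>T i\<close> then applies.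
  Both the demiclosedness of \<open>CC\<close> and the location of cluster points rest on
  this.\<close>

lemma weak_limit_in_F:
  assumes x: "x \<in> U" and u: "\<And>k. u k \<in> U" and wk: "weakly_tendsto u x"
    and lim: "(\<lambda>k. bregman f (u k) (CC (u k))) \<longlonglongrightarrow> 0"
  shows "x \<in> F"
proof -
  have "x \<in> Fix (T i)" if i: "i \<in> {1..m}" for i
  proof -
    have "(\<lambda>k. bregman f (T j (u k)) (CC (u k))) \<longlonglongrightarrow> 0" if "j \<in> {1..m}" for j
      using lim by (simp add: CC_equidistant[OF u that])
    then have "(\<lambda>k. bregman f (u k) (T i (u k))) \<longlonglongrightarrow> 0"
      using transfer[OF u lim _ i] by blast
    then show ?thesis
      using demiclosed[OF i] x u wk T_in_U[OF i u] unfolding f_demiclosed_def by blast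
  qed
  then show ?thesis using x by (simp add: F_def)
qed

lemma CC_demiclosed: "f_demiclosed f U CC"
  unfolding f_demiclosed_def
proof (intro ballI allI impI)
  fix x xs
  assume x: "x \<in> U \<inter> U"
    and *: "(\<forall>k. xs k \<in> U \<and> CC (xs k) \<in> U) \<and> weakly_tendsto xs x
      \<and> (\<lambda>k. bregman f (xs k) (CC (xs k))) \<longlonglongrightarrow> 0"
  have "x \<in> F" by (rule weak_limit_in_F[of x xs]) (use x * in auto)
  then show "x \<in> Fix CC" by (simp add: Fix_def CC_fixed)
qed

lemma iterate_weakly_convergent:
  assumes y: "y \<in> U"
    and cluster: "\<And>r p. strict_mono r \<Longrightarrow> weakly_tendsto (\<lambda>k. (CC ^^ r k) y) p \<Longrightarrow> p \<in> U"
  obtains p where "p \<in> F" "weakly_tendsto (\<lambda>k. (CC ^^ k) y) p"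
proof -
  define xs where "xs k = (CC ^^ k) y" for k
  have xsU: "xs k \<in> U" for k unfolding xs_def by (rule iterate_U[OF y])
  obtain z where z: "z \<in> F" using F_ne by blast
  have bd: "bounded (range xs)"
    by (rule bounded_subset[OF D_coercive[OF F_U[OF z], of "D y z"]])
       (use xsU interior_in_edom iterate_D_le[OF y z] in \<open>auto simp: xs_def\<close>)
  have clF: "p \<in> F" if r: "strict_mono r" and p: "weakly_tendsto (xs \<circ> r) p" for r p
  proof (rule weak_limit_in_F)
    show "p \<in> U" using cluster[OF r] p by (simp add: xs_def o_def)
    show "(xs \<circ> r) k \<in> U" for k by (simp add: xsU)
    show "weakly_tendsto (xs \<circ> r) p" by (rule p)
    show "(\<lambda>k. bregman f ((xs \<circ> r) k) (CC ((xs \<circ> r) k))) \<longlonglongrightarrow> 0"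
      using LIMSEQ_subseq_LIMSEQ[OF iterate_asymptotically_regular[OF y] r] by (simp add: xs_def o_def)
  qed
  obtain r p where r: "strict_mono r" "weakly_tendsto (xs \<circ> r) p"
    using bounded_imp_weakly_convergent_subseq[OF bd] by blast
  have p: "p \<in> F" using clF[OF r] .
  have "weakly_tendsto xs p"
  proof (rule weakly_tendsto_of_unique_cluster[OF bd])
    fix s q assume s: "strict_mono s" "weakly_tendsto (xs \<circ> s) q"
    have q: "q \<in> F" using clF[OF s] .
    obtain L where L: "(\<lambda>k. D (xs k) p) \<longlonglongrightarrow> L"
      using iterate_D_convergent[OF y p] unfolding xs_def by blast
    obtain M where M: "(\<lambda>k. D (xs k) q) \<longlonglongrightarrow> M"
      using iterate_D_convergent[OF y q] unfolding xs_def by blast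
    let ?g = "grad f q - grad f p"
    \<comment> \<open>Collects the terms free of \<open>xs k\<close>: the quadratic-like part
      \<open>\<phi> (xs k)\<close> cancels in the difference of the two distances, leaving an inner
      product that weak limits can see.\<close>
    define c where "c = \<phi> p - \<phi> q + inner (grad f q) q - inner (grad f p) p"
    have "(\<lambda>k. D (xs k) p - D (xs k) q + c) \<longlonglongrightarrow> L - M + c"
      by (intro tendsto_intros L M)
    moreover have "D (xs k) p - D (xs k) q + c = inner (xs k) ?g" for k
      by (simp add: D_def c_def inner_simps inner_commute)
    ultimately have lim: "(\<lambda>k. inner (xs k) ?g) \<longlonglongrightarrow> L - M + c" by simp
    have sub: "inner x ?g = L - M + c" if "strict_mono t" "weakly_tendsto (xs \<circ> t) x" for t x
    proof (rule LIMSEQ_unique)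
      show "(\<lambda>k. inner ((xs \<circ> t) k) ?g) \<longlonglongrightarrow> inner x ?g"
        using that(2) by (simp add: weakly_tendsto_def)
      show "(\<lambda>k. inner ((xs \<circ> t) k) ?g) \<longlonglongrightarrow> L - M + c"
        using LIMSEQ_subseq_LIMSEQ[OF lim that(1)] by (simp add: o_def)
    qed
    \<comment> \<open>Both cluster points yield the same limit value.\<close>
    have "inner ?g (q - p) = 0"
      using sub[OF s] sub[OF r] by (simp add: inner_diff_right inner_commute)
    then show "q = p" by (rule gradient_strictly_monotone[OF F_U[OF q] F_U[OF p]])
  qed
  with p show ?thesis unfolding xs_def[abs_def] by (rule that)
qed

end

end

theorem theorem4p12:
  fixes f :: "'a::{real_inner, complete_space} \<Rightarrow> ereal"
    and T :: "nat \<Rightarrow> 'a \<Rightarrow> 'a"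
    and m :: nat
    and F :: "'a set"
    and y :: 'a
  assumes proper: "proper_fun f" and lsc: "lsc_fun f" and cvx: "convex_fun f"
    and leg: "legendre f"
    and F_def: "F = interior (edom f) \<inter> (\<Inter>i\<in>{1..m}. Fix (T i))"
    and F_ne: "F \<noteq> {}" and F_closed: "closed F" and F_convex: "convex F"
    and iso: "\<forall>i\<in>{1..m}. bregman_isometric f (T i)"
    and atmost1: "\<forall>u \<in> interior (edom f). \<forall>v w. v \<in> fwd_cc_set f m T u \<and> w \<in> fwd_cc_set f m T u \<longrightarrow> v = w"
    and y: "y \<in> interior (edom f)"
  shows
    "(\<forall>x \<in> edom f. \<forall>z \<in> F. \<forall>i\<in>{1..m}. bregman f (T i x) z = bregman f x z)
   \<and> (\<forall>z \<in> F. \<exists>p. fwd_cc_set f m T y = {p} \<and> bwd_proj f (affine hull (Sset m T y)) z = {p}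
                 \<and> p \<in> interior (edom f))
   \<and> (\<forall>k. (fwd_cc f m T ^^ k) y \<in> interior (edom f) \<and>
          fwd_cc_set f m T ((fwd_cc f m T ^^ k) y) = {(fwd_cc f m T ^^ Suc k) y})
   \<and> fwd_bregman_monotone f (\<Inter>i\<in>{1..m}. Fix (T i)) (\<lambda>k. (fwd_cc f m T ^^ k) y)
   \<and> (\<forall>z \<in> F. \<exists>L::real. (\<lambda>k. bregman f ((fwd_cc f m T ^^ k) y) z) \<longlonglongrightarrow> ereal L)
   \<and> ((\<lambda>k. bregman f ((fwd_cc f m T ^^ k) y) ((fwd_cc f m T ^^ Suc k) y)) \<longlonglongrightarrow> 0)
   \<and> ((\<forall>i\<in>{1..m}. f_demiclosed f UNIV (T i)) \<and>
      (\<forall>u. (\<forall>k. u k \<in> interior (edom f)) \<and>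
           (\<lambda>k. bregman f (u k) (fwd_cc f m T (u k))) \<longlonglongrightarrow> 0 \<and>
           (\<forall>i\<in>{1..m}. (\<lambda>k. bregman f (T i (u k)) (fwd_cc f m T (u k))) \<longlonglongrightarrow> 0)
         \<longrightarrow> (\<forall>i\<in>{1..m}. (\<lambda>k. bregman f (u k) (T i (u k))) \<longlonglongrightarrow> 0))
      \<longrightarrow> f_demiclosed f (interior (edom f)) (fwd_cc f m T)
        \<and> ((\<forall>p. (\<exists>r. strict_mono r \<and> weakly_tendsto (\<lambda>k. (fwd_cc f m T ^^ (r k)) y) p)
                 \<longrightarrow> p \<in> interior (edom f))
           \<longrightarrow> (\<exists>p \<in> F. weakly_tendsto (\<lambda>k. (fwd_cc f m T ^^ k) y) p)))"
proof -
  interpret bregman_circumcenter f T m F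
    using proper lsc cvx leg F_def F_ne iso atmost1 by unfold_locales blast+
  have "f_demiclosed f U CC
      \<and> ((\<forall>p. (\<exists>r. strict_mono r \<and> weakly_tendsto (\<lambda>k. (CC ^^ (r k)) y) p) \<longrightarrow> p \<in> U)
           \<longrightarrow> (\<exists>p \<in> F. weakly_tendsto (\<lambda>k. (CC ^^ k) y) p))"
    if dem: "\<forall>i\<in>{1..m}. f_demiclosed f UNIV (T i)"
      and tr: "\<forall>u. (\<forall>k. u k \<in> U) \<and> (\<lambda>k. bregman f (u k) (CC (u k))) \<longlonglongrightarrow> 0 \<and>
           (\<forall>i\<in>{1..m}. (\<lambda>k. bregman f (T i (u k)) (CC (u k))) \<longlonglongrightarrow> 0)
         \<longrightarrow> (\<forall>i\<in>{1..m}. (\<lambda>k. bregman f (u k) (T i (u k))) \<longlonglongrightarrow> 0)"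
  proof (intro conjI impI)
    have dem': "f_demiclosed f UNIV (T i)" if "i \<in> {1..m}" for i
      using dem that by blast
    have tr': "(\<lambda>k. bregman f (u k) (T i (u k))) \<longlonglongrightarrow> 0"
      if "\<And>k. u k \<in> U" "(\<lambda>k. bregman f (u k) (CC (u k))) \<longlonglongrightarrow> 0"
        "\<And>j. j \<in> {1..m} \<Longrightarrow> (\<lambda>k. bregman f (T j (u k)) (CC (u k))) \<longlonglongrightarrow> 0" "i \<in> {1..m}" for u i
      using tr that by blast
    show "f_demiclosed f U CC" by (rule CC_demiclosed[OF dem' tr'])
    assume cl: "\<forall>p. (\<exists>r. strict_mono r \<and> weakly_tendsto (\<lambda>k. (CC ^^ (r k)) y) p) \<longrightarrow> p \<in> U"
    show "\<exists>p \<in> F. weakly_tendsto (\<lambda>k. (CC ^^ k) y) p"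
    proof (rule iterate_weakly_convergent[OF dem' tr' y])
      show "p \<in> U" if "strict_mono r" "weakly_tendsto (\<lambda>k. (CC ^^ r k) y) p" for r p
        using cl that by blast
    qed auto
  qed
  moreover have "\<forall>x \<in> edom f. \<forall>z \<in> F. \<forall>i\<in>{1..m}. bregman f (T i x) z = bregman f x z"
    using bregman_T(2) by blast
  moreover have "\<forall>z \<in> F. \<exists>p. fwd_cc_set f m T y = {p} \<and> bwd_proj f (aff_S y) z = {p} \<and> p \<in> U"
    using circumcenter[OF y] by blast
  \<comment> \<open>\<open>CC\<close> is total through \<open>the_elem\<close>, so well-definedness
    is expressed by each circumcenter set being the singleton of the next iterate.\<close>
  moreover have "\<forall>k. (CC ^^ k) y \<in> U \<and> fwd_cc_set f m T ((CC ^^ k) y) = {(CC ^^ Suc k) y}"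
    using iterate_U[OF y] fwd_cc_set_eq by simp
  moreover have "\<forall>z \<in> F. \<exists>L::real. (\<lambda>k. bregman f ((CC ^^ k) y) z) \<longlonglongrightarrow> ereal L"
  proof
    fix z assume z: "z \<in> F"
    obtain L where "(\<lambda>k. D ((CC ^^ k) y) z) \<longlonglongrightarrow> L" using iterate_D_convergent[OF y z] by blast
    then have "(\<lambda>k. bregman f ((CC ^^ k) y) z) \<longlonglongrightarrow> ereal L"
      by (simp add: bregman_eq[OF interior_in_edom[OF iterate_U[OF y]] F_U[OF z]])
    then show "\<exists>L::real. (\<lambda>k. bregman f ((CC ^^ k) y) z) \<longlonglongrightarrow> ereal L" by blast
  qed
  ultimately show ?thesis
    using iterate_monotone[OF y] iterate_asymptotically_regular[OF y] by blast
qed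

end
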